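(* In the setting of the context, let $0\le M\le 2s$ and let $y_1,\dots,y_{2s+1}$ be as in the context. Define for a $2s$-tuple $\bar u=(u_1,\dots,u_{2s})$ $$X^-_M(\bar u)=\mathcal G^-_{2s}(\bar u)F_M\sum_{M'=0}^{2s}Q_{MM'}\prod_{i=1}^{2s}\Big(U_i-\frac{r_0}{q+q^{-1}}\theta^\diamond_{M'}\Big),\qquad X^+_M(\bar u)=\mathcal G^+_{2s}(\bar u)\frac{\kappa F_M}{\nu^{[*,\diamond,\cdot]}}\sum_{M'=0}^{2s}\frac{Q_{MM'}}{H_{M'}}\prod_{i=1}^{2s}\Big(U_i-\frac{r_0}{q+q^{-1}}\theta^\diamond_{M'}\Big).$$ Then for $\epsilon\in\{+,-\}$ and every $j=1,\dots,2s+1$: $\sum_{k=1}^{2s+1}(L^\epsilon_{jk}-\delta_{jk}\theta_M)\,X^\epsilon_M(\bar{\mathcal Y}_k)=0$.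
   Context: $q\in\mathbb C^*$ not a root of unity, $s\in\{0,\tfrac12,1,\dots\}$; $b(x)=x-x^{-1}$; $(x;p)_n=\prod_{k=0}^{n-1}(1-xp^k)$, $(x_1,\dots,x_r;p)_n=\prod_i(x_i;p)_n$; ${}_4\phi_3\!\left({x_1,x_2,x_3,x_4\atop y_1,y_2,y_3}\right)=\sum_{n\ge0}\frac{(x_1,x_2,x_3,x_4;q^2)_n}{(q^2,y_1,y_2,y_3;q^2)_n}q^{2n}$. Labels $\{\cdot,*,\diamond\}$, $\mathsf b^\cdot=\mathsf b$, $\mathsf c^\cdot=\mathsf c$. Nonzero $r_0,\mathsf b^a,\mathsf c^a$ with $r_0^{-2}=\mathsf b\mathsf c=\mathsf b^*\mathsf c^*=\mathsf b^\diamond\mathsf c^\diamond$, chosen so that all denominators below are nonzero; $\theta^a_M=\mathsf b^aq^{2M}+\mathsf c^aq^{-2M}$, $\theta_M=\theta^\cdot_M$; $\omega^{\{a,b,c\}}=-(q-q^{-1})^2(\theta^a_s\theta^b_s-r_0^{-1}(q^{2s+1}+q^{-2s-1})\theta^c_s)$; $\rho=-\frac{(q^2-q^{-2})^2}{r_0^2}$, $\eta=\frac{q+q^{-1}}{r_0}\omega^{\{\cdot,\diamond,*\}}$, $\eta^*=\frac{q+q^{-1}}{r_0}\omega^{\{*,\diamond,\cdot\}}$. The numbers $y_1,\dots,y_{2s+1}\in\mathbb C^*$ satisfy $y_j^4\notin\{1,q^{-2},q^{-4}\}$ and $\frac{qy_j^2+q^{-1}y_j^{-2}}{q+q^{-1}}$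 pairwise distinct; $\bar{\mathcal Y}_k$ is $(y_1,\dots,y_{2s+1})$ with $y_k$ deleted. For $\bar u$: $U_i=\frac{qu_i^2+q^{-1}u_i^{-2}}{q+q^{-1}}$, $\mathcal G^\epsilon_n(\bar u)=(\epsilon(q+q^{-1})q^{-\epsilon(n+1)}\beta_\epsilon)^n\prod_ib(u_i^2)u_i^{-\epsilon}$ with $\beta_-=\mathsf b$, $\beta_+=\mathsf c^*$. Functions: $\zeta\in\mathbb C^*$ with $\zeta^{-2}=\mathsf b^\diamond r_0q^{2s}$; $\Lambda^\epsilon_1(u)=\frac{q^{-2s-1}}{u^\epsilon}(q^{2s+1}u\zeta^{-1}-u^{-1}\zeta)(q^{2s+1}u\zeta-u^{-1}\zeta^{-1})(u\mathsf c^*q^{-2s}+u^{-1}\mathsf bq^{2s})\big(u(\mathsf c/\mathsf c^* )^{\frac{1-\epsilon}2}+u^{-1}(\mathsf b^*/\mathsf b)^{\frac{1+\epsilon}2}\big)$, $\Lambda^\epsilon_2(u)=\frac{(u^2-u^{-2})q^{-2s-1}}{u^\epsilon(qu^2-q^{-1}u^{-2})}(q^{2s-1}u^{-1}\zeta-u\zeta^{-1})(q^{2s-1}u^{-1}\zeta^{-1}-u\zeta)(q^2u\mathsf bq^{2s}+u^{-1}\mathsf c^*q^{-2s})\big(q^2u(\mathsf b^*/\mathsf b)^{\frac{1+\epsilon}2}+u^{-1}(\mathsf c/\mathsf c^* )^{\frac{1-\epsilon}2}\big)$; $g(u,\bar u)=\prod_{u_i\in\bar u}(b(u/u_i)b(quu_i))^{-1}$;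 $Y_\epsilon(u|\bar u)=\frac{u^{2\epsilon+1}\Lambda^\epsilon_1(u)}{b(u^2)b(qu^2)}\prod_{u_i\in\bar u}b(u/(qu_i))b(uu_i)+\frac{q^{-\epsilon-1}u^{-1}\Lambda^\epsilon_2(u)}{b(u^2)b(q^2u^2)}\prod_{u_i\in\bar u}b(qu/u_i)b(q^2uu_i)-\delta_{\epsilon,+}q^{-1-4s}\mathsf c^*\prod_{j=0}^{2s}b(q^{1/2+j-s}u\zeta)b(q^{1/2+j-s}u\zeta^{-1})$; $L^\epsilon_{jk}=\big(\frac{y_j}{y_k}\big)^{\epsilon}\frac{b(y_k^2)}{b(y_j^2)}g(y_k,\bar{\mathcal Y}_k)Y_\epsilon(y_k|\bar{\mathcal Y}_j)+\delta_{jk}\frac{(q+q^{-1})^2}{\rho b(y_j^2)b(q^2y_j^2)}\big(\eta^*+\eta\frac{qy_j^2+q^{-1}y_j^{-2}}{q+q^{-1}}\big)$. Constants: $F_M=\prod_{k=0}^{M-1}\frac{\mathsf cq^{-2k-2}+r_0q^{-1}\mathsf c^*\mathsf b^\diamond}{\mathsf bq^{2k}+r_0q^{-1}\mathsf c^*\mathsf b^\diamond}$, $H_M=\prod_{k=0}^{M-1}q^{4k}\frac{\mathsf b^\diamond}{\mathsf c^\diamond}\frac{\mathsf c^\diamond q^{-2k}+r_0q\mathsf c^*\mathsf b}{\mathsf b^\diamond q^{2k}+r_0q^{-1}\mathsf c^*\mathsf b}$, $\kappa=(-1)^{2s}q^{2s(2s-1)}\frac{(q^2r_0^2\mathsf b^2,q^2r_0^2(\mathsf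 b^\diamond)^2,q^2r_0^2(\mathsf b^* )^2;q^2)_{2s}}{(-\frac{qr_0\mathsf b\mathsf b^\diamond}{\mathsf b^*},-\frac{qr_0\mathsf b\mathsf b^*}{\mathsf b^\diamond},-\frac{qr_0\mathsf b^\diamond\mathsf b^*}{\mathsf b};q^2)_{2s}}$. For a triple $(x,y,z)$ of distinct labels: $R^{[x,z]}_M(\theta^y_N)={}_4\phi_3\!\left({q^{-2M},\frac{\mathsf b^x}{\mathsf c^x}q^{2M},q^{-2N},\frac{\mathsf b^y}{\mathsf c^y}q^{2N}\atop -\frac{\mathsf b^x\mathsf c^z}{\mathsf c^y}r_0q,\,-\frac{\mathsf b^y\mathsf b^z}{\mathsf c^x}r_0q^{4s+1},\,q^{-4s}}\right)$, $\tilde k^{[x,y,z]}_M=\frac{(-\frac{\mathsf b^x\mathsf c^z}{\mathsf c^y}r_0q,-\frac{\mathsf b^y\mathsf b^z}{\mathsf c^x}r_0q^{4s+1},\frac{\mathsf b^x}{\mathsf c^x},q^{-4s};q^2)_M}{(q^2,-\frac{\mathsf b^x\mathsf c^z}{\mathsf b^y}r_0q^{1-4s},-\frac{\mathsf c^y\mathsf b^z}{\mathsf c^x}r_0q,\frac{\mathsf b^x}{\mathsf c^x}q^{4s+2};q^2)_M}\frac{1-\frac{\mathsf b^x}{\mathsf c^x}q^{4M}}{(\mathsf b^y/\mathsf c^y)^M(1-\mathsf b^x/\mathsf c^x)}$, $\nu^{[x,y,z]}=\frac{(\frac{\mathsf b^x}{\mathsf c^x}q^2,\frac{\mathsf b^y}{\mathsf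 c^y}q^2;q^2)_{2s}}{(-\frac{\mathsf b^y\mathsf b^z}{\mathsf c^x}r_0q^{4s+1})^{2s}(-\frac{\mathsf b^x\mathsf c^z}{\mathsf b^y}r_0q^{1-4s},-\frac{\mathsf c^x\mathsf c^z}{\mathsf c^y}r_0q^{1-4s};q^2)_{2s}}$, and $Q_{MM'}=(\nu^{[\diamond,\cdot,*]})^{-1}\tilde k^{[\diamond,\cdot,*]}_{M'}R^{[\diamond,*]}_{M'}(\theta_M)$. Standing assumption: there exist $A,A^*\in\mathrm{End}(\mathbb C^{2s+1})$ satisfying, with $A^\diamond=\frac{r_0}{q^2-q^{-2}}(qA^*A-q^{-1}AA^* )+\frac{r_0\omega^{\{\cdot,*,\diamond\}}}{(q-q^{-1})(q^2-q^{-2})}\mathbb I$, the relations $[A^a,[A^a,A^b]_q]_{q^{-1}}=-\frac{(q^2-q^{-2})^2}{r_0^2}A^b+\omega^{\{a,b,c\}}A^a+\frac{q+q^{-1}}{r_0}\omega^{\{a,c,b\}}\mathbb I$ for all ordered pairs $(a,b)$ of distinct labels ($c$ the third, $A^\cdot=A$, $[X,Y]_q=qXY-q^{-1}YX$), such that $(A,A^* )$, $(A^*,A^\diamond)$, $(A^\diamond,A)$ are Leonard pairs (each diagonalizable, irreducible tridiagonal in an eigenbasis of the other) with eigenvalue orderings $\theta_M,\theta^*_M,\theta^\diamond_M$. *)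

theory Defs
  imports Complex_Main "Jordan_Normal_Form.Matrix"
begin

text \<open>Conventions. The half-integer s is encoded by the natural number n = 2s, so that
  q^(2s) = q^n, q^(4s) = q^(2n), etc.  The six parameters b^a, c^a for the labels
  (dot, star, diamond) are b c bs cs bd cd.  The sign epsilon is an integer e in {1,-1}.
  Tuples u-bar are lists of complex numbers.\<close>

definition qpoch :: "complex \<Rightarrow> complex \<Rightarrow> nat \<Rightarrow> complex" where
  "qpoch x p m = (\<Prod>k<m. 1 - x * p ^ k)"

definition bf :: "complex \<Rightarrow> complex" where
  "bf x = x - inverse x"

definition phi43 :: "complex \<Rightarrow> complex \<Rightarrow> complex \<Rightarrow> complex \<Rightarrow> complex
    \<Rightarrow> complex \<Rightarrow> complex \<Rightarrow> complex \<Rightarrow> complex" where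
  "phi43 q x1 x2 x3 x4 z1 z2 z3 =
     (\<Sum>m. (qpoch x1 (q^2) m * qpoch x2 (q^2) m * qpoch x3 (q^2) m * qpoch x4 (q^2) m)
          / (qpoch (q^2) (q^2) m * qpoch z1 (q^2) m * qpoch z2 (q^2) m * qpoch z3 (q^2) m)
          * q ^ (2 * m))"

text \<open>th q ba ca k = ba q^k + ca q^(-k); so theta^a_M = th q ba ca (2M), theta^a_s = th q ba ca n\<close>
definition th :: "complex \<Rightarrow> complex \<Rightarrow> complex \<Rightarrow> int \<Rightarrow> complex" where
  "th q ba ca k = ba * q powi k + ca * q powi (-k)"

definition omega :: "complex \<Rightarrow> nat \<Rightarrow> complex \<Rightarrow> complex \<times> complex \<Rightarrow> complex \<times> complex
    \<Rightarrow> complex \<times> complex \<Rightarrow> complex" where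
  "omega q n r0 pa pb pc =
     - ((q - inverse q)^2) * (th q (fst pa) (snd pa) (int n) * th q (fst pb) (snd pb) (int n)
        - inverse r0 * (q powi (int n + 1) + q powi (- int n - 1)) * th q (fst pc) (snd pc) (int n))"

definition rho :: "complex \<Rightarrow> complex \<Rightarrow> complex" where
  "rho q r0 = - ((q^2 - q powi (-2))^2) / r0^2"

definition eta :: "complex \<Rightarrow> nat \<Rightarrow> complex \<Rightarrow> complex \<Rightarrow> complex \<Rightarrow> complex \<Rightarrow> complex
    \<Rightarrow> complex \<Rightarrow> complex \<Rightarrow> complex" where
  "eta q n r0 b c bs cs bd cd = (q + inverse q) / r0 * omega q n r0 (b,c) (bd,cd) (bs,cs)"

definition etas :: "complex \<Rightarrow> nat \<Rightarrow> complex \<Rightarrow> complex \<Rightarrow> complex \<Rightarrow> complex \<Rightarrow> complex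
    \<Rightarrow> complex \<Rightarrow> complex \<Rightarrow> complex" where
  "etas q n r0 b c bs cs bd cd = (q + inverse q) / r0 * omega q n r0 (bs,cs) (bd,cd) (b,c)"

definition Lam1 :: "complex \<Rightarrow> nat \<Rightarrow> complex \<Rightarrow> complex \<Rightarrow> complex \<Rightarrow> complex \<Rightarrow> complex
    \<Rightarrow> int \<Rightarrow> complex \<Rightarrow> complex" where
  "Lam1 q n b c bs cs zeta e u =
     q powi (- int n - 1) / u powi e
     * (q ^ (n + 1) * u / zeta - zeta / u)
     * (q ^ (n + 1) * u * zeta - inverse (u * zeta))
     * (u * cs * q powi (- int n) + b * q ^ n / u)
     * (u * (c / cs) powi ((1 - e) div 2) + (bs / b) powi ((1 + e) div 2) / u)"

definition Lam2 :: "complex \<Rightarrow> nat \<Rightarrow> complex \<Rightarrow> complex \<Rightarrow> complex \<Rightarrow> complex \<Rightarrow> complex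
    \<Rightarrow> int \<Rightarrow> complex \<Rightarrow> complex" where
  "Lam2 q n b c bs cs zeta e u =
     (u^2 - inverse (u^2)) * q powi (- int n - 1)
       / (u powi e * (q * u^2 - inverse (q * u^2)))
     * (q powi (int n - 1) * zeta / u - u / zeta)
     * (q powi (int n - 1) / (u * zeta) - u * zeta)
     * (q^2 * u * b * q ^ n + cs * q powi (- int n) / u)
     * (q^2 * u * (bs / b) powi ((1 + e) div 2) + (c / cs) powi ((1 - e) div 2) / u)"

definition gfun :: "complex \<Rightarrow> complex \<Rightarrow> complex list \<Rightarrow> complex" where
  "gfun q u us = prod_list (map (\<lambda>ui. inverse (bf (u / ui) * bf (q * u * ui))) us)"

text \<open>Y_e(u|us); the half-integer power q^(1/2+j-s) is (csqrt q) powi (1+2j-n)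
  (the product does not depend on the choice of square root).\<close>
definition Yfun :: "complex \<Rightarrow> nat \<Rightarrow> complex \<Rightarrow> complex \<Rightarrow> complex \<Rightarrow> complex \<Rightarrow> complex
    \<Rightarrow> int \<Rightarrow> complex \<Rightarrow> complex list \<Rightarrow> complex" where
  "Yfun q n b c bs cs zeta e u us =
     u powi (2 * e + 1) * Lam1 q n b c bs cs zeta e u / (bf (u^2) * bf (q * u^2))
       * prod_list (map (\<lambda>ui. bf (u / (q * ui)) * bf (u * ui)) us)
   + q powi (- e - 1) / u * Lam2 q n b c bs cs zeta e u / (bf (u^2) * bf (q^2 * u^2))
       * prod_list (map (\<lambda>ui. bf (q * u / ui) * bf (q^2 * u * ui)) us)
   - (if e = 1 then q powi (- 1 - 2 * int n) * cs
        * (\<Prod>j\<in>{0..n}. bf (csqrt q powi (1 + 2 * int j - int n) * u * zeta)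
                         * bf (csqrt q powi (1 + 2 * int j - int n) * u / zeta))
      else 0)"

definition Ybar :: "nat \<Rightarrow> (nat \<Rightarrow> complex) \<Rightarrow> nat \<Rightarrow> complex list" where
  "Ybar n y k = map y (filter (\<lambda>i. i \<noteq> k) [1..<n + 2])"

definition Lmat :: "complex \<Rightarrow> nat \<Rightarrow> complex \<Rightarrow> complex \<Rightarrow> complex \<Rightarrow> complex \<Rightarrow> complex
    \<Rightarrow> complex \<Rightarrow> complex \<Rightarrow> complex \<Rightarrow> (nat \<Rightarrow> complex) \<Rightarrow> int \<Rightarrow> nat \<Rightarrow> nat \<Rightarrow> complex" where
  "Lmat q n r0 b c bs cs bd cd zeta y e j k =
     (y j / y k) powi e * bf ((y k)^2) / bf ((y j)^2) * gfun q (y k) (Ybar n y k)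
       * Yfun q n b c bs cs zeta e (y k) (Ybar n y j)
   + (if j = k then (q + inverse q)^2 / (rho q r0 * bf ((y j)^2) * bf (q^2 * (y j)^2))
        * (etas q n r0 b c bs cs bd cd + eta q n r0 b c bs cs bd cd
             * ((q * (y j)^2 + inverse (q * (y j)^2)) / (q + inverse q)))
      else 0)"

definition Ufun :: "complex \<Rightarrow> complex \<Rightarrow> complex" where
  "Ufun q u = (q * u^2 + inverse (q * u^2)) / (q + inverse q)"

definition Gfun :: "complex \<Rightarrow> complex \<Rightarrow> complex \<Rightarrow> int \<Rightarrow> nat \<Rightarrow> complex list \<Rightarrow> complex" where
  "Gfun q b cs e m us =
     (of_int e * (q + inverse q) * q powi (- e * (int m + 1)) * (if e = 1 then cs else b)) ^ m
     * prod_list (map (\<lambda>ui. bf (ui^2) * ui powi (- e)) us)"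

definition Ffun :: "complex \<Rightarrow> complex \<Rightarrow> complex \<Rightarrow> complex \<Rightarrow> complex \<Rightarrow> complex \<Rightarrow> nat \<Rightarrow> complex" where
  "Ffun q r0 b c cs bd M =
     (\<Prod>k<M. (c * q powi (- 2 * int k - 2) + r0 * inverse q * cs * bd)
            / (b * q ^ (2 * k) + r0 * inverse q * cs * bd))"

definition Hfun :: "complex \<Rightarrow> complex \<Rightarrow> complex \<Rightarrow> complex \<Rightarrow> complex \<Rightarrow> complex \<Rightarrow> nat \<Rightarrow> complex" where
  "Hfun q r0 b cs bd cd M =
     (\<Prod>k<M. q ^ (4 * k) * (bd / cd) * (cd * q powi (- 2 * int k) + r0 * q * cs * b)
            / (bd * q ^ (2 * k) + r0 * inverse q * cs * b))"

definition kappa_num :: "complex \<Rightarrow> nat \<Rightarrow> complex \<Rightarrow> complex \<Rightarrow> complex \<Rightarrow> complex \<Rightarrow> complex" where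
  "kappa_num q n r0 b bs bd =
     qpoch (q^2 * r0^2 * b^2) (q^2) n * qpoch (q^2 * r0^2 * bd^2) (q^2) n
     * qpoch (q^2 * r0^2 * bs^2) (q^2) n"

definition kappa_den :: "complex \<Rightarrow> nat \<Rightarrow> complex \<Rightarrow> complex \<Rightarrow> complex \<Rightarrow> complex \<Rightarrow> complex" where
  "kappa_den q n r0 b bs bd =
     qpoch (- q * r0 * b * bd / bs) (q^2) n * qpoch (- q * r0 * b * bs / bd) (q^2) n
     * qpoch (- q * r0 * bd * bs / b) (q^2) n"

definition kappa :: "complex \<Rightarrow> nat \<Rightarrow> complex \<Rightarrow> complex \<Rightarrow> complex \<Rightarrow> complex \<Rightarrow> complex" where
  "kappa q n r0 b bs bd =
     (-1) ^ n * q ^ (n * (n - 1)) * kappa_num q n r0 b bs bd / kappa_den q n r0 b bs bd"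

text \<open>R^{[x,z]}_M(theta^y_N) for a triple (x,y,z) of labels given by parameter pairs\<close>
definition Rfun :: "complex \<Rightarrow> nat \<Rightarrow> complex \<Rightarrow> complex \<times> complex \<Rightarrow> complex \<times> complex
    \<Rightarrow> complex \<times> complex \<Rightarrow> nat \<Rightarrow> nat \<Rightarrow> complex" where
  "Rfun q n r0 px py pz M N =
     phi43 q (q powi (- 2 * int M)) (fst px / snd px * q ^ (2 * M))
             (q powi (- 2 * int N)) (fst py / snd py * q ^ (2 * N))
             (- fst px * snd pz / snd py * r0 * q)
             (- fst py * fst pz / snd px * r0 * q ^ (2 * n + 1))
             (q powi (- 2 * int n))"

definition kt_num :: "complex \<Rightarrow> nat \<Rightarrow> complex \<Rightarrow> complex \<times> complex \<Rightarrow> complex \<times> complex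
    \<Rightarrow> complex \<times> complex \<Rightarrow> nat \<Rightarrow> complex" where
  "kt_num q n r0 px py pz M =
     qpoch (- fst px * snd pz / snd py * r0 * q) (q^2) M
     * qpoch (- fst py * fst pz / snd px * r0 * q ^ (2 * n + 1)) (q^2) M
     * qpoch (fst px / snd px) (q^2) M * qpoch (q powi (- 2 * int n)) (q^2) M"

definition kt_den :: "complex \<Rightarrow> nat \<Rightarrow> complex \<Rightarrow> complex \<times> complex \<Rightarrow> complex \<times> complex
    \<Rightarrow> complex \<times> complex \<Rightarrow> nat \<Rightarrow> complex" where
  "kt_den q n r0 px py pz M =
     qpoch (q^2) (q^2) M
     * qpoch (- fst px * snd pz / fst py * r0 * q powi (1 - 2 * int n)) (q^2) M
     * qpoch (- snd py * fst pz / snd px * r0 * q) (q^2) M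
     * qpoch (fst px / snd px * q ^ (2 * n + 2)) (q^2) M"

definition ktilde :: "complex \<Rightarrow> nat \<Rightarrow> complex \<Rightarrow> complex \<times> complex \<Rightarrow> complex \<times> complex
    \<Rightarrow> complex \<times> complex \<Rightarrow> nat \<Rightarrow> complex" where
  "ktilde q n r0 px py pz M =
     kt_num q n r0 px py pz M / kt_den q n r0 px py pz M
     * (1 - fst px / snd px * q ^ (4 * M))
       / ((fst py / snd py) ^ M * (1 - fst px / snd px))"

definition nu_den :: "complex \<Rightarrow> nat \<Rightarrow> complex \<Rightarrow> complex \<times> complex \<Rightarrow> complex \<times> complex
    \<Rightarrow> complex \<times> complex \<Rightarrow> complex" where
  "nu_den q n r0 px py pz =
     (- fst py * fst pz / snd px * r0 * q ^ (2 * n + 1)) ^ n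
     * qpoch (- fst px * snd pz / fst py * r0 * q powi (1 - 2 * int n)) (q^2) n
     * qpoch (- snd px * snd pz / snd py * r0 * q powi (1 - 2 * int n)) (q^2) n"

definition nu :: "complex \<Rightarrow> nat \<Rightarrow> complex \<Rightarrow> complex \<times> complex \<Rightarrow> complex \<times> complex
    \<Rightarrow> complex \<times> complex \<Rightarrow> complex" where
  "nu q n r0 px py pz =
     qpoch (fst px / snd px * q^2) (q^2) n * qpoch (fst py / snd py * q^2) (q^2) n
     / nu_den q n r0 px py pz"

definition Qfun :: "complex \<Rightarrow> nat \<Rightarrow> complex \<Rightarrow> complex \<Rightarrow> complex \<Rightarrow> complex \<Rightarrow> complex
    \<Rightarrow> complex \<Rightarrow> complex \<Rightarrow> nat \<Rightarrow> nat \<Rightarrow> complex" where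
  "Qfun q n r0 b c bs cs bd cd M M' =
     inverse (nu q n r0 (bd,cd) (b,c) (bs,cs)) * ktilde q n r0 (bd,cd) (b,c) (bs,cs) M'
     * Rfun q n r0 (bd,cd) (b,c) (bs,cs) M' M"

definition Xfun :: "complex \<Rightarrow> nat \<Rightarrow> complex \<Rightarrow> complex \<Rightarrow> complex \<Rightarrow> complex \<Rightarrow> complex
    \<Rightarrow> complex \<Rightarrow> complex \<Rightarrow> int \<Rightarrow> nat \<Rightarrow> complex list \<Rightarrow> complex" where
  "Xfun q n r0 b c bs cs bd cd e M us =
     (if e = 1 then
        Gfun q b cs 1 n us * (kappa q n r0 b bs bd * Ffun q r0 b c cs bd M
          / nu q n r0 (bs,cs) (bd,cd) (b,c))
        * (\<Sum>M'=0..n. Qfun q n r0 b c bs cs bd cd M M' / Hfun q r0 b cs bd cd M'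
             * prod_list (map (\<lambda>ui. Ufun q ui - r0 / (q + inverse q) * th q bd cd (2 * int M')) us))
      else
        Gfun q b cs (-1) n us * Ffun q r0 b c cs bd M
        * (\<Sum>M'=0..n. Qfun q n r0 b c bs cs bd cd M M'
             * prod_list (map (\<lambda>ui. Ufun q ui - r0 / (q + inverse q) * th q bd cd (2 * int M')) us)))"

text \<open>"all denominators below are nonzero"\<close>
definition nondeg :: "complex \<Rightarrow> nat \<Rightarrow> complex \<Rightarrow> complex \<Rightarrow> complex \<Rightarrow> complex \<Rightarrow> complex
    \<Rightarrow> complex \<Rightarrow> complex \<Rightarrow> bool" where
  "nondeg q n r0 b c bs cs bd cd \<longleftrightarrow>
     (\<forall>k<n. b * q ^ (2 * k) + r0 * inverse q * cs * bd \<noteq> 0) \<and>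
     (\<forall>k<n. bd * q ^ (2 * k) + r0 * inverse q * cs * b \<noteq> 0) \<and>
     (\<forall>M\<le>n. Hfun q r0 b cs bd cd M \<noteq> 0) \<and>
     kappa_den q n r0 b bs bd \<noteq> 0 \<and>
     (\<forall>M\<le>n. kt_den q n r0 (bd,cd) (b,c) (bs,cs) M \<noteq> 0) \<and> 1 - bd / cd \<noteq> 0 \<and>
     nu_den q n r0 (bd,cd) (b,c) (bs,cs) \<noteq> 0 \<and> nu q n r0 (bd,cd) (b,c) (bs,cs) \<noteq> 0 \<and>
     nu_den q n r0 (bs,cs) (bd,cd) (b,c) \<noteq> 0 \<and> nu q n r0 (bs,cs) (bd,cd) (b,c) \<noteq> 0 \<and>
     (\<forall>m\<le>n. qpoch (- bd * cs / c * r0 * q) (q^2) m \<noteq> 0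
            \<and> qpoch (- b * bs / cd * r0 * q ^ (2 * n + 1)) (q^2) m \<noteq> 0
            \<and> qpoch (q powi (- 2 * int n)) (q^2) m \<noteq> 0)"

definition diag_of :: "nat \<Rightarrow> (nat \<Rightarrow> complex) \<Rightarrow> complex mat" where
  "diag_of m d = mat m m (\<lambda>(i, j). if i = j then d i else 0)"

definition irred_tridiag :: "nat \<Rightarrow> complex mat \<Rightarrow> bool" where
  "irred_tridiag m T \<longleftrightarrow> T \<in> carrier_mat m m \<and>
     (\<forall>i<m. \<forall>j<m. (i > j + 1 \<or> j > i + 1) \<longrightarrow> T $$ (i, j) = 0) \<and>
     (\<forall>i. i + 1 < m \<longrightarrow> T $$ (i + 1, i) \<noteq> 0 \<and> T $$ (i, i + 1) \<noteq> 0)"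

definition diag_tridiag :: "nat \<Rightarrow> complex mat \<Rightarrow> complex mat \<Rightarrow> (nat \<Rightarrow> complex) \<Rightarrow> bool" where
  "diag_tridiag m A B d \<longleftrightarrow>
     (\<exists>P Pi. P \<in> carrier_mat m m \<and> Pi \<in> carrier_mat m m \<and> P * Pi = 1\<^sub>m m \<and> Pi * P = 1\<^sub>m m
        \<and> Pi * A * P = diag_of m d \<and> irred_tridiag m (Pi * B * P))"

definition leonard_pair :: "nat \<Rightarrow> complex mat \<Rightarrow> complex mat \<Rightarrow> (nat \<Rightarrow> complex)
    \<Rightarrow> (nat \<Rightarrow> complex) \<Rightarrow> bool" where
  "leonard_pair m A B dA dB \<longleftrightarrow> A \<in> carrier_mat m m \<and> B \<in> carrier_mat m m \<and>
     diag_tridiag m A B dA \<and> diag_tridiag m B A dB"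

definition qcomm :: "complex \<Rightarrow> complex mat \<Rightarrow> complex mat \<Rightarrow> complex mat" where
  "qcomm q X Y = q \<cdot>\<^sub>m (X * Y) - inverse q \<cdot>\<^sub>m (Y * X)"

definition aw_rel :: "complex \<Rightarrow> nat \<Rightarrow> complex \<Rightarrow> complex mat \<times> complex \<times> complex
    \<Rightarrow> complex mat \<times> complex \<times> complex \<Rightarrow> complex \<times> complex \<Rightarrow> bool" where
  "aw_rel q n r0 Aa Ab pc \<longleftrightarrow>
     qcomm (inverse q) (fst Aa) (qcomm q (fst Aa) (fst Ab)) =
       rho q r0 \<cdot>\<^sub>m fst Ab + omega q n r0 (snd Aa) (snd Ab) pc \<cdot>\<^sub>m fst Aa
       + ((q + inverse q) / r0 * omega q n r0 (snd Aa) pc (snd Ab)) \<cdot>\<^sub>m 1\<^sub>m (n + 1)"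

definition Adia :: "complex \<Rightarrow> nat \<Rightarrow> complex \<Rightarrow> complex \<Rightarrow> complex \<Rightarrow> complex \<Rightarrow> complex
    \<Rightarrow> complex \<Rightarrow> complex \<Rightarrow> complex mat \<Rightarrow> complex mat \<Rightarrow> complex mat" where
  "Adia q n r0 b c bs cs bd cd A As =
     (r0 / (q^2 - q powi (-2))) \<cdot>\<^sub>m (q \<cdot>\<^sub>m (As * A) - inverse q \<cdot>\<^sub>m (A * As))
     + (r0 * omega q n r0 (b,c) (bs,cs) (bd,cd) / ((q - inverse q) * (q^2 - q powi (-2))))
         \<cdot>\<^sub>m 1\<^sub>m (n + 1)"

definition standing :: "complex \<Rightarrow> nat \<Rightarrow> complex \<Rightarrow> complex \<Rightarrow> complex \<Rightarrow> complex \<Rightarrow> complex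
    \<Rightarrow> complex \<Rightarrow> complex \<Rightarrow> bool" where
  "standing q n r0 b c bs cs bd cd \<longleftrightarrow>
     (\<exists>A As. A \<in> carrier_mat (n + 1) (n + 1) \<and> As \<in> carrier_mat (n + 1) (n + 1) \<and>
        (let Ad = Adia q n r0 b c bs cs bd cd A As;
             X0 = (A, (b, c)); X1 = (As, (bs, cs)); X2 = (Ad, (bd, cd)) in
          aw_rel q n r0 X0 X1 (bd, cd) \<and> aw_rel q n r0 X1 X0 (bd, cd) \<and>
          aw_rel q n r0 X0 X2 (bs, cs) \<and> aw_rel q n r0 X2 X0 (bs, cs) \<and>
          aw_rel q n r0 X1 X2 (b, c) \<and> aw_rel q n r0 X2 X1 (b, c) \<and>
          leonard_pair (n + 1) A As (\<lambda>M. th q b c (2 * int M)) (\<lambda>M. th q bs cs (2 * int M)) \<and>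
          leonard_pair (n + 1) As Ad (\<lambda>M. th q bs cs (2 * int M)) (\<lambda>M. th q bd cd (2 * int M)) \<and>
          leonard_pair (n + 1) Ad A (\<lambda>M. th q bd cd (2 * int M)) (\<lambda>M. th q b c (2 * int M))))"

end

theory Submission
  imports Defs "HOL-Computational_Algebra.Polynomial"
begin

text \<open>Put \<open>p = q\<^sup>2\<close>, \<open>v = q u\<^sup>2\<close> and \<open>V = v + 1/v\<close>. Up to constants, \<open>X(u)\<close> is a gauge factor times
  the pairing, over the nodes \<open>r\<^sub>0 \<theta>\<^sup>\<diamond>\<^sub>N\<close>, of a weight \<open>w\<^sub>N\<close> with the monic polynomial in \<open>V\<close> whose roots are
  the \<open>V\<^sub>i\<close>. The entry \<open>L\<^sub>j\<^sub>k\<close> is the Lagrange coefficient at \<open>V\<^sub>k\<close> times \<open>h(V\<^sub>k)\<close>, where \<open>h\<close> is the image of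
  \<open>\<Prod>\<^sub>i\<^sub>\<noteq>\<^sub>j (V - V\<^sub>i)\<close> under an Askey-Wilson type second-order \<open>q\<close>-difference operator. This operator acts
  tridiagonally on the Newton basis of the nodes, and for \<open>\<epsilon> = +\<close> the inhomogeneous term of \<open>Y\<close> removes exactly the
  excess leading coefficient; so \<open>h\<close> is a polynomial of degree at most \<open>n\<close>. Lagrange interpolation then evaluates
  the sum over \<open>k\<close> as \<open>\<Sum>\<^sub>N w\<^sub>N h(node N)\<close>. On the nodes the operator becomes a tridiagonal matrix which is
  self-adjoint for the \<open>q\<close>-Racah weight and has the terminating \<open>\<^sub>4\<phi>\<^sub>3\<close> as an eigenvector for \<open>\<theta>\<^sub>M\<close>; the operator
  for \<open>\<epsilon> = +\<close> is conjugate to the one for \<open>\<epsilon> = -\<close> by the diagonal matrix \<open>H\<close>.\<close>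

section \<open>Newton and Lagrange interpolation at \<open>q\<close>-quadratic nodes\<close>

definition joukowski :: "complex \<Rightarrow> complex" where
  "joukowski v = v + inverse v"

lemma joukowski_inverse [simp]: "joukowski (inverse v) = joukowski v"
  by (simp add: joukowski_def add.commute)

text \<open>The right-hand side is factored so that products over \<open>w = A * p ^ k\<close>
  become pairs of q-shifted factorials in \<open>v\<close> and \<open>1 / v\<close>.\<close>

lemma joukowski_diff:
  assumes "v \<noteq> 0" "w \<noteq> 0"
  shows "joukowski v - joukowski w = - ((1 - w * v) * (1 - w / v) / w)"
  using assms by (simp add: joukowski_def field_simps)

definition qnode :: "complex \<Rightarrow> complex \<Rightarrow> nat \<Rightarrow> complex" where
  "qnode A p k = joukowski (A * p ^ k)"

text \<open>At \<open>joukowski v\<close> this is, up to a constant factor, the Askey-Wilson basis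
  function (A v, A / v; p)_m.\<close>

definition newton_poly :: "complex \<Rightarrow> complex \<Rightarrow> nat \<Rightarrow> complex poly" where
  "newton_poly A p m = (\<Prod>k<m. [:- qnode A p k, 1:])"

lemma newton_poly_0 [simp]: "newton_poly A p 0 = 1"
  by (simp add: newton_poly_def)

lemma newton_poly_Suc: "newton_poly A p (Suc m) = [:- qnode A p m, 1:] * newton_poly A p m"
  by (simp add: newton_poly_def mult.commute)

lemma poly_newton_poly: "poly (newton_poly A p m) x = (\<Prod>k<m. x - qnode A p k)"
  by (simp add: newton_poly_def poly_prod)

lemma poly_newton_poly_Suc:
  "poly (newton_poly A p (Suc m)) x = (x - qnode A p m) * poly (newton_poly A p m) x"
  by (simp add: poly_newton_poly mult.commute)

lemma poly_newton_poly_node: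
  assumes "N < m"
  shows "poly (newton_poly A p m) (qnode A p N) = 0"
  using assms by (auto simp: poly_newton_poly)

lemma degree_newton_poly: "degree (newton_poly A p m) \<le> m"
proof (induction m)
  case (Suc m)
  have "degree (newton_poly A p (Suc m)) \<le> degree [:- qnode A p m, 1:] + degree (newton_poly A p m)"
    unfolding newton_poly_Suc by (rule degree_mult_le)
  with Suc show ?case by simp
qed simp

text \<open>Induction on \<open>S\<close>: one more linear factor sends the Newton polynomial of
  index k to that of index k + 1 plus a multiple of itself. The top coefficient 1 is recorded
  because the correction in degree n is later weighted by it.\<close>

lemma newton_poly_span:
  assumes "finite S"
  shows "\<exists>c. c (card S) = 1 \<and>
    (\<Prod>i\<in>S. [:- V i, 1:]) = (\<Sum>k\<le>card S. smult (c k) (newton_poly A p k))"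
  using assms
proof (induction S rule: finite_induct)
  case empty
  show ?case by (intro exI[of _ "\<lambda>_. 1"]) simp
next
  case (insert a S)
  then obtain c where c: "c (card S) = 1"
    and eq: "(\<Prod>i\<in>S. [:- V i, 1:]) = (\<Sum>k\<le>card S. smult (c k) (newton_poly A p k))" by blast
  define c' where "c' k = (if k = 0 then 0 else c (k - 1)) +
      (if k \<le> card S then c k * (qnode A p k - V a) else 0)" for k
  have step: "[:- V a, 1:] * newton_poly A p k =
      newton_poly A p (Suc k) + smult (qnode A p k - V a) (newton_poly A p k)" for k
    by (simp add: newton_poly_Suc algebra_simps smult_diff_left smult_add_left)
  have "(\<Prod>i\<in>insert a S. [:- V i, 1:]) = [:- V a, 1:] * (\<Sum>k\<le>card S. smult (c k) (newton_poly A p k))"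
    using insert by (simp add: eq)
  also have "\<dots> = (\<Sum>k\<le>card S. smult (c k) ([:- V a, 1:] * newton_poly A p k))"
    by (simp only: sum_distrib_left mult_smult_right)
  also have "\<dots> = (\<Sum>k\<le>card S. smult (c k) (newton_poly A p (Suc k)))
      + (\<Sum>k\<le>card S. smult (c k * (qnode A p k - V a)) (newton_poly A p k))"
    by (simp only: step smult_add_right smult_smult sum.distrib)
  also have "(\<Sum>k\<le>card S. smult (c k) (newton_poly A p (Suc k))) =
      (\<Sum>k\<le>Suc (card S). smult (if k = 0 then 0 else c (k - 1)) (newton_poly A p k))"
    by (subst sum.atMost_Suc_shift) simp
  also have "(\<Sum>k\<le>card S. smult (c k * (qnode A p k - V a)) (newton_poly A p k)) =
      (\<Sum>k\<le>Suc (card S). smult (if k \<le> card S then c k * (qnode A p k - V a) else 0) (newton_poly A p k))"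
    by simp
  finally have "(\<Prod>i\<in>insert a S. [:- V i, 1:]) = (\<Sum>k\<le>Suc (card S). smult (c' k) (newton_poly A p k))"
    by (simp only: c'_def smult_add_left sum.distrib)
  moreover have "c' (Suc (card S)) = 1" using c by (simp add: c'_def)
  ultimately show ?case using insert by (intro exI[of _ c']) simp
qed

text \<open>Both sides are polynomials in \<open>x\<close> of degree below \<open>card S\<close>
  that agree at the \<open>card S\<close> distinct points \<open>V k\<close>.\<close>

lemma lagrange_interpolation:
  fixes h :: "complex poly"
  assumes S: "finite S" "inj_on V S" "degree h < card S"
  shows "(\<Sum>k\<in>S. poly h (V k) / (\<Prod>i\<in>S - {k}. V k - V i) * (\<Prod>i\<in>S - {k}. x - V i)) = poly h x"
proof -
  define w where "w k = poly h (V k) / (\<Prod>i\<in>S - {k}. V k - V i)" for k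
  define L where "L = (\<Sum>k\<in>S. smult (w k) (\<Prod>i\<in>S - {k}. [:- V i, 1:]))"
  have L: "poly L z = (\<Sum>k\<in>S. w k * (\<Prod>i\<in>S - {k}. z - V i))" for z
    by (simp add: L_def poly_sum poly_prod)
  have "poly L (V j) = poly h (V j)" if j: "j \<in> S" for j
  proof -
    have "w k * (\<Prod>i\<in>S - {k}. V j - V i) = (if k = j then poly h (V j) else 0)" if "k \<in> S" for k
    proof (cases "k = j")
      case True
      have "(\<Prod>i\<in>S - {j}. V j - V i) \<noteq> 0"
        using S j by (auto simp: inj_on_def)
      with True show ?thesis by (simp add: w_def)
    next
      case False
      then have "(\<Prod>i\<in>S - {k}. V j - V i) = 0"
        using S j by (intro prod_zero) auto
      with False show ?thesis by simp
    qed
    then show ?thesis using S j by (simp add: L sum.delta)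
  qed
  moreover have "degree L < card S"
  proof -
    have "degree L \<le> card S - 1" unfolding L_def
    proof (intro degree_sum_le S)
      fix k assume k: "k \<in> S"
      have "degree (\<Prod>i\<in>S - {k}. [:- V i, 1:]) \<le> (\<Sum>i\<in>S - {k}. degree [:- V i, 1:])"
        using degree_prod_sum_le[of "S - {k}" "\<lambda>i. [:- V i, 1:]"] S by (simp add: o_def)
      also have "\<dots> = card S - 1" using S k by simp
      finally show "degree (smult (w k) (\<Prod>i\<in>S - {k}. [:- V i, 1:])) \<le> card S - 1"
        using degree_smult_le order_trans by blast
    qed
    with S show ?thesis by linarith
  qed
  ultimately have "L = h"
    using S by (intro poly_eqI_degree[of "V ` S"]) (auto simp: card_image)
  then show ?thesis using L[of x] by (simp add: w_def)
qed

text \<open>Replacing \<open>v\<close> by \<open>p * v\<close> advances (A v; p) by one step and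
  sets (A / v; p) back by one. After multiplication by \<open>1 - A * v\<close> everything except
  three boundary factors is the Newton polynomial of index \<open>m\<close>.\<close>

lemma newton_poly_shift:
  assumes nz: "v \<noteq> 0" "p \<noteq> 0" "A \<noteq> 0"
  shows "(1 - A * v) * poly (newton_poly A p (Suc m)) (joukowski (p * v)) =
    - ((1 - A * p ^ m * v) * (1 - A * p ^ Suc m * v) * (1 - A / (p * v)) / (A * p ^ m))
      * poly (newton_poly A p m) (joukowski v)"
proof (induction m)
  case 0
  show ?case
    using nz by (simp add: newton_poly_Suc qnode_def joukowski_def field_simps)
next
  case (Suc m)
  let ?w = "A * p ^ Suc m"
  have w: "?w \<noteq> 0" using nz by simp
  have 1: "poly (newton_poly A p (Suc (Suc m))) (joukowski (p * v)) =
      (joukowski (p * v) - joukowski ?w) * poly (newton_poly A p (Suc m)) (joukowski (p * v))"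
    by (simp add: poly_newton_poly_Suc[of A p "Suc m"] qnode_def)
  have 2: "poly (newton_poly A p (Suc m)) (joukowski v) =
      (joukowski v - joukowski (A * p ^ m)) * poly (newton_poly A p m) (joukowski v)"
    by (simp add: poly_newton_poly_Suc qnode_def)
  have "(1 - A * v) * poly (newton_poly A p (Suc (Suc m))) (joukowski (p * v)) =
      - ((1 - ?w * (p * v)) * (1 - ?w / (p * v)) / ?w) *
      (- ((1 - A * p ^ m * v) * (1 - ?w * v) * (1 - A / (p * v)) / (A * p ^ m))
      * poly (newton_poly A p m) (joukowski v))"
    unfolding 1 joukowski_diff[OF _ w, of "p * v", simplified nz, simplified] Suc[symmetric]
    using nz by (simp add: joukowski_diff)
  also have "\<dots> = - ((1 - ?w * v) * (1 - A * p ^ Suc (Suc m) * v) * (1 - A / (p * v)) / ?w) *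
      (- ((1 - A * p ^ m * v) * (1 - A * p ^ m / v) / (A * p ^ m)) * poly (newton_poly A p m) (joukowski v))"
  proof -
    have "?w / (p * v) = A * p ^ m / v" "?w * (p * v) = A * p ^ Suc (Suc m) * v"
      using nz by simp_all
    moreover have "- (x1 * x2 / w) * (- (x3 * x4 * x5 / u) * F) = - (x4 * x1 * x5 / w) * (- (x3 * x2 / u) * F)"
      for x1 x2 x3 x4 x5 w u F :: complex
      by (simp add: divide_inverse mult_ac)
    ultimately show ?thesis by simp
  qed
  also have "\<dots> = - ((1 - ?w * v) * (1 - A * p ^ Suc (Suc m) * v) * (1 - A / (p * v)) / ?w)
      * poly (newton_poly A p (Suc m)) (joukowski v)"
    unfolding 2 using joukowski_diff[of v "A * p ^ m"] nz by simp
  finally show ?case .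
qed

text \<open>Both values are multiples of the Newton polynomial of index \<open>m\<close>. The
  remaining bracket vanishes for \<open>p * v\<^sup>2 = 1\<close>, where \<open>p * v\<close> and
  \<open>v\<close> have the same \<open>joukowski\<close> value; this factor will cancel a pole of
  \<open>shift_coeff\<close>.\<close>

lemma newton_poly_diff:
  assumes nz: "v \<noteq> 0" "p \<noteq> 0" "A \<noteq> 0"
  shows "(1 - A * v) * (poly (newton_poly A p (Suc m)) (joukowski (p * v))
      - poly (newton_poly A p (Suc m)) (joukowski v)) =
    (1 - p ^ Suc m) * (1 - p * v\<^sup>2) / (p ^ Suc m * v) * (1 - A * p ^ m * v)
      * poly (newton_poly A p m) (joukowski v)"
proof -
  have "poly (newton_poly A p (Suc m)) (joukowski v) =
      (joukowski v - joukowski (A * p ^ m)) * poly (newton_poly A p m) (joukowski v)"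
    by (simp add: poly_newton_poly_Suc qnode_def)
  also have "\<dots> = - ((1 - A * p ^ m * v) * (1 - A * p ^ m / v) / (A * p ^ m))
      * poly (newton_poly A p m) (joukowski v)"
    using nz by (simp add: joukowski_diff)
  finally have 2: "poly (newton_poly A p (Suc m)) (joukowski v) = \<dots>" .
  define P where "P = p ^ m"
  have P: "P \<noteq> 0" using nz by (simp add: P_def)
  have "- ((1 - A * P * v) * (1 - A * (p * P) * v) * (1 - A / (p * v)) / (A * P))
      - (1 - A * v) * - ((1 - A * P * v) * (1 - A * P / v) / (A * P)) =
      (1 - p * P) * (1 - p * v\<^sup>2) / (p * P * v) * (1 - A * P * v)"
  proof -
    have "(1 - A * (p * P) * v) * (1 - A / (p * v)) - (1 - A * v) * (1 - A * P / v)
        = - (1 - p * P) * A * (1 - p * v\<^sup>2) / (p * v)"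
      using nz by (simp add: field_simps power2_eq_square)
    then have "- ((1 - A * P * v) / (A * P) * ((1 - A * (p * P) * v) * (1 - A / (p * v)) - (1 - A * v) * (1 - A * P / v)))
        = (1 - p * P) * (1 - p * v\<^sup>2) / (p * P * v) * (1 - A * P * v)"
      using nz P by (simp add: field_simps power2_eq_square)
    moreover have "- (x1 * x2 * x3 / u) - x4 * - (x1 * x5 / u) = - (x1 / u * (x2 * x3 - x4 * x5))"
      for x1 x2 x3 x4 x5 u :: complex
      by (simp add: divide_inverse algebra_simps)
    ultimately show ?thesis by simp
  qed
  then show ?thesis
    unfolding right_diff_distrib[of "1 - A * v"] newton_poly_shift[OF nz] 2 P_def
    by (simp only: mult.assoc[symmetric] left_diff_distrib[symmetric] power_Suc)
qed

section \<open>Askey-Wilson type operators\<close>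

definition lattice_op :: "nat \<Rightarrow> (nat \<Rightarrow> complex) \<Rightarrow> (nat \<Rightarrow> complex) \<Rightarrow> (nat \<Rightarrow> complex)
    \<Rightarrow> (nat \<Rightarrow> complex) \<Rightarrow> nat \<Rightarrow> complex" where
  "lattice_op n u w E f N = (if N < n then u N * (f (Suc N) - f N) else 0)
     + (if 0 < N then w N * (f (N - 1) - f N) else 0) + E N * f N"

text \<open>The condition \<open>A D p\<^sup>n = 1\<close> truncates the lattice at node \<open>n\<close>. The last condition says that the Newton
  polynomial of degree \<open>n + 1\<close>, with coefficient \<open>c0\<close>, cancels the term of degree \<open>n + 1\<close> in the image of a monic
  polynomial of degree \<open>n\<close>.\<close>
locale aw_operator =
  fixes p A C D \<gamma> l0 l1 l2 E0 E1 c0 :: complex and n :: nat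
  assumes p_nz: "p \<noteq> 0" and A_nz: "A \<noteq> 0" and AD: "A * D * p ^ n = 1"
    and lead: "E1 + \<gamma> * (1 - p ^ n) / p ^ n * l2 = c0"
begin

text \<open>The usual fourth linear factor is left as a general combination of 1, \<open>v\<close>
  and \<open>1 / v\<close>, so that the operators for both signs of epsilon and the term comparing
  them are instances.\<close>

definition shift_coeff :: "complex \<Rightarrow> complex" where
  "shift_coeff v = \<gamma> * (1 - A * v) * (1 - C * v) * (1 - D * v) * (l0 + l1 * v + l2 / v)
     / ((1 - v\<^sup>2) * (1 - p * v\<^sup>2))"

text \<open>\<open>half_term\<close> is what remains of \<open>shift_coeff v\<close> times a difference of Newton polynomials after the
  factors \<open>1 - A v\<close> and \<open>1 - p v\<^sup>2\<close> cancel. In this form nothing breaks down at the extreme nodes, where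
  \<open>p v\<^sup>2 = 1\<close> or \<open>v\<^sup>2 = p\<close> is possible.\<close>
definition half_term :: "complex \<Rightarrow> complex \<Rightarrow> complex" where
  "half_term X v = (1 - X * v) * (1 - C * v) * (1 - D * v) * (l0 + l1 * v + l2 / v) / (v * (1 - v\<^sup>2))"

definition symm_poly :: "complex \<Rightarrow> complex poly" where
  "symm_poly X = (let e1 = X + C + D; e2 = X * C + X * D + C * D; e3 = X * C * D in
     [:l0 * (e3 - e1) + l1 * (1 - e2) + l2 * (e2 - 1), l0 + l1 * e3 - l2 * e1, l2:])"

text \<open>The sum is invariant under \<open>v\<close> to \<open>inverse v\<close> and its poles at
  \<open>v\<^sup>2 = 1\<close> cancel, which leaves a quadratic in \<open>joukowski v\<close> with
  leading coefficient \<open>l2\<close>.\<close>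

lemma half_term_symm:
  assumes v: "v \<noteq> 0" "v\<^sup>2 \<noteq> 1"
  shows "half_term X v + half_term X (inverse v) = poly (symm_poly X) (joukowski v)"
proof -
  have 1: "1 - v\<^sup>2 \<noteq> 0" using v by simp
  have a: "half_term X v = (1 - X * v) * (1 - C * v) * (1 - D * v) * (l0 * v + l1 * v\<^sup>2 + l2) / (v\<^sup>2 * (1 - v\<^sup>2))"
    using v 1 by (simp add: half_term_def field_simps power2_eq_square)
  have "half_term X (inverse v) = (1 - X / v) * (1 - C / v) * (1 - D / v) * (l0 + l1 / v + l2 * v)
      / (inverse v * (1 - inverse v ^ 2))"
    by (simp add: half_term_def divide_inverse)
  also have "inverse v * (1 - inverse v ^ 2) = - (1 - v\<^sup>2) / v ^ 3"
    using v by (simp add: field_simps power2_eq_square power3_eq_cube)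
  also have "(1 - X / v) * (1 - C / v) * (1 - D / v) * (l0 + l1 / v + l2 * v)
      = (v - X) * (v - C) * (v - D) * (l0 * v + l1 + l2 * v\<^sup>2) / v ^ 4"
    using v by (simp add: field_simps power2_eq_square power4_eq_xxxx)
  also have "\<dots> / (- (1 - v\<^sup>2) / v ^ 3) =
      - ((v - X) * (v - C) * (v - D) * (l0 * v + l1 + l2 * v\<^sup>2)) * v / (v\<^sup>2 * (1 - v\<^sup>2))"
  proof -
    have "Z / v ^ 4 / (- (1 - v\<^sup>2) / v ^ 3) = - Z * v / (v\<^sup>2 * (1 - v\<^sup>2))" for Z
      using v 1 by (simp add: divide_simps) (simp add: eval_nat_numeral algebra_simps)
    then show ?thesis .
  qed
  finally have b: "half_term X (inverse v) = \<dots>" .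
  have c: "poly (symm_poly X) (joukowski v) * v\<^sup>2 =
      (l0 * (X * C * D - (X + C + D)) + l1 * (1 - (X * C + X * D + C * D))
        + l2 * ((X * C + X * D + C * D) - 1)) * v\<^sup>2
      + (l0 + l1 * (X * C * D) - l2 * (X + C + D)) * v * (v\<^sup>2 + 1) + l2 * (v\<^sup>2 + 1)\<^sup>2"
    using v by (simp add: symm_poly_def Let_def joukowski_def power2_eq_square field_simps)
  have "(1 - X * v) * (1 - C * v) * (1 - D * v) * (l0 * v + l1 * v\<^sup>2 + l2)
      + - ((v - X) * (v - C) * (v - D) * (l0 * v + l1 + l2 * v\<^sup>2)) * v =
      (poly (symm_poly X) (joukowski v) * v\<^sup>2) * (1 - v\<^sup>2)"
    unfolding c by (simp add: eval_nat_numeral algebra_simps)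
  then show ?thesis
    unfolding a b add_divide_distrib[symmetric] using v 1 by simp
qed

text \<open>By \<open>newton_poly_diff\<close>, the factor \<open>1 - A * v\<close> of
  \<open>shift_coeff\<close> is traded for \<open>1 - A * p ^ m * v\<close> while
  \<open>1 - p * v\<^sup>2\<close> cancels. This is the origin of the first argument of
  \<open>half_term\<close>.\<close>

lemma shift_coeff_diff:
  assumes "v \<noteq> 0" "v\<^sup>2 \<noteq> 1" "p * v\<^sup>2 \<noteq> 1"
  shows "shift_coeff v * (poly (newton_poly A p (Suc m)) (joukowski (p * v))
      - poly (newton_poly A p (Suc m)) (joukowski v)) =
    \<gamma> * (1 - p ^ Suc m) / p ^ Suc m * poly (newton_poly A p m) (joukowski v) * half_term (A * p ^ m) v"
    (is "_ * ?\<Delta> = _")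
proof -
  define L where "L = l0 + l1 * v + l2 / v"
  have nz: "v \<noteq> 0" "1 - v\<^sup>2 \<noteq> 0" "1 - p * v\<^sup>2 \<noteq> 0" using assms by auto
  have "shift_coeff v * ?\<Delta> = \<gamma> * (1 - C * v) * (1 - D * v) * L / ((1 - v\<^sup>2) * (1 - p * v\<^sup>2)) * ((1 - A * v) * ?\<Delta>)"
    by (simp add: shift_coeff_def L_def mult_ac)
  also have "\<dots> = \<gamma> * (1 - p ^ Suc m) / p ^ Suc m * poly (newton_poly A p m) (joukowski v) * half_term (A * p ^ m) v"
    unfolding newton_poly_diff[OF assms(1) p_nz A_nz] half_term_def L_def[symmetric]
    using nz p_nz by (simp add: divide_simps mult_ac)
  finally show ?thesis .
qed

section \<open>Images of the Newton polynomials\<close>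

text \<open>At \<open>m = 0\<close> the index \<open>m - 1\<close> is truncated to 0, which does no
  harm because \<open>1 - p ^ 0\<close> vanishes.\<close>

definition image_poly :: "nat \<Rightarrow> complex poly" where
  "image_poly m = [:E0, E1:] * newton_poly A p m
     + smult (\<gamma> * (1 - p ^ m) / p ^ m) (symm_poly (A * p ^ (m - 1)) * newton_poly A p (m - 1))
     - (if m = n then smult c0 (newton_poly A p (Suc n)) else 0)"

text \<open>The operator raises the Newton index by at most one. For \<open>m < n\<close> the result
  stays within degree \<open>n\<close>; for \<open>m = n\<close> the coefficient of index
  \<open>n + 1\<close> vanishes by \<open>lead\<close>.\<close>

lemma degree_image_poly:
  assumes "m \<le> n"
  shows "degree (image_poly m) \<le> n"
proof -
  define s where "s = \<gamma> * (1 - p ^ m) / p ^ m"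
  define t where "t = (if m = n then c0 else 0)"
  have E: "[:E0, E1:] * newton_poly A p m =
      smult E1 (newton_poly A p (Suc m)) + smult (E0 + E1 * qnode A p m) (newton_poly A p m)"
    by (simp add: newton_poly_Suc algebra_simps smult_diff_left smult_add_left smult_diff_right)
  obtain \<beta> \<delta> where T: "smult s (symm_poly (A * p ^ (m - 1)) * newton_poly A p (m - 1)) =
      smult (s * l2) (newton_poly A p (Suc m)) + smult \<beta> (newton_poly A p m) + smult \<delta> (newton_poly A p (m - 1))"
  proof (cases m)
    case 0
    then have "s = 0" by (simp add: s_def)
    then show ?thesis by (intro that[of 0 0]) simp
  next
    case (Suc k)
    obtain a0 a1 where S: "symm_poly (A * p ^ k) = [:a0, a1, l2:]"
      by (auto simp: symm_poly_def Let_def)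
    let ?x = "qnode A p k" and ?y = "qnode A p (Suc k)"
    \<comment> \<open>The quadratic is expanded at the nodes \<open>k\<close> and
      \<open>Suc k\<close>, so that multiplication by the Newton polynomial of index
      \<open>k\<close> continues the Newton basis.\<close>
    have "[:a0, a1, l2:] = smult l2 ([:- ?y, 1:] * [:- ?x, 1:])
        + smult (a1 + l2 * (?x + ?y)) [:- ?x, 1:] + [:a0 + ?x * (a1 + l2 * ?x):]"
      by (simp add: algebra_simps)
    then have "smult s (symm_poly (A * p ^ k) * newton_poly A p k) =
      smult (s * l2) (newton_poly A p (Suc (Suc k))) + smult (s * (a1 + l2 * (?x + ?y))) (newton_poly A p (Suc k))
      + smult (s * (a0 + ?x * (a1 + l2 * ?x))) (newton_poly A p k)"
      unfolding S newton_poly_Suc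
      by (simp only: distrib_right smult_add_right mult_smult_left smult_smult mult.assoc) simp
    then show ?thesis using Suc by (intro that) auto
  qed
  have "image_poly m = smult (E1 + s * l2 - t) (newton_poly A p (Suc m))
      + smult (E0 + E1 * qnode A p m + \<beta>) (newton_poly A p m) + smult \<delta> (newton_poly A p (m - 1))"
    unfolding image_poly_def E T[unfolded s_def] t_def
    by (simp add: s_def smult_add_left smult_diff_left algebra_simps)
  moreover have "degree (smult (E1 + s * l2 - t) (newton_poly A p (Suc m))) \<le> n"
  proof (cases "m = n")
    case True
    then have "E1 + s * l2 - t = 0" using lead by (simp add: s_def t_def)
    then show ?thesis by simp
  next
    case False
    then show ?thesis using assms degree_newton_poly[of A p "Suc m"]
      by (intro order_trans[OF degree_smult_le]) linarith
  qed
  moreover have "degree (smult c (newton_poly A p k)) \<le> n" if "k \<le> n" for c k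
    using degree_smult_le[of c "newton_poly A p k"] degree_newton_poly[of A p k] that by linarith
  ultimately show ?thesis using assms by (auto intro!: degree_add_le)
qed

lemma poly_image_poly:
  "poly (image_poly m) x = (E0 + E1 * x) * poly (newton_poly A p m) x
     + \<gamma> * (1 - p ^ m) / p ^ m * (poly (symm_poly (A * p ^ (m - 1))) x * poly (newton_poly A p (m - 1)) x)
     - (if m = n then c0 else 0) * poly (newton_poly A p (Suc n)) x"
  by (simp add: image_poly_def algebra_simps)

lemma image_poly_generic:
  assumes v: "v \<noteq> 0" "v\<^sup>2 \<noteq> 1" "p * v\<^sup>2 \<noteq> 1" "v\<^sup>2 \<noteq> p"
  shows "poly (image_poly m) (joukowski v) =
    shift_coeff v * (poly (newton_poly A p m) (joukowski (p * v)) - poly (newton_poly A p m) (joukowski v))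
    + shift_coeff (inverse v) * (poly (newton_poly A p m) (joukowski (v / p)) - poly (newton_poly A p m) (joukowski v))
    + (E0 + E1 * joukowski v) * poly (newton_poly A p m) (joukowski v)
    - (if m = n then c0 else 0) * poly (newton_poly A p (Suc n)) (joukowski v)"
proof (cases m)
  case 0
  then show ?thesis by (simp add: poly_image_poly)
next
  case (Suc k)
  have iv: "inverse v \<noteq> 0" "(inverse v)\<^sup>2 \<noteq> 1" "p * (inverse v)\<^sup>2 \<noteq> 1"
    using v by (auto simp: field_simps)
  have jv: "joukowski (p * inverse v) = joukowski (v / p)"
    using joukowski_inverse[of "v / p"] by (simp add: divide_inverse mult.commute)
  show ?thesis
    unfolding poly_image_poly Suc shift_coeff_diff[OF v(1-3)]
      shift_coeff_diff[OF iv, unfolded joukowski_inverse jv]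
    by (simp add: half_term_symm[OF v(1,2), symmetric] algebra_simps)
qed

text \<open>Multiplying or dividing by \<open>p\<close> leads from a node to its neighbours. At the
  two ends the contribution of the missing neighbour is zero, at node \<open>n\<close> thanks to
  \<open>AD\<close>; the pole conditions are therefore required only where a neighbour
  exists.\<close>

lemma image_poly_node:
  assumes N: "N \<le> n"
    and s0: "(A * p ^ N)\<^sup>2 \<noteq> 1" and s1: "N < n \<Longrightarrow> p * (A * p ^ N)\<^sup>2 \<noteq> 1"
    and s2: "0 < N \<Longrightarrow> (A * p ^ N)\<^sup>2 \<noteq> p"
  shows "poly (image_poly m) (qnode A p N) =
    lattice_op n (\<lambda>N. shift_coeff (A * p ^ N)) (\<lambda>N. shift_coeff (inverse (A * p ^ N)))
      (\<lambda>N. E0 + E1 * qnode A p N) (\<lambda>N. poly (newton_poly A p m) (qnode A p N)) N"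
proof -
  define v where "v = A * p ^ N"
  have v: "v \<noteq> 0" using A_nz p_nz by (simp add: v_def)
  have node: "qnode A p N = joukowski v" by (simp add: qnode_def v_def)
  have top: "poly (newton_poly A p (Suc n)) (qnode A p N) = 0"
    using N by (intro poly_newton_poly_node) simp
  show ?thesis
  proof (cases m)
    case 0
    then show ?thesis using top by (simp add: poly_image_poly lattice_op_def)
  next
    case (Suc k)
    define s where "s = \<gamma> * (1 - p ^ Suc k) / p ^ Suc k * poly (newton_poly A p k) (joukowski v)"
    have up: "(if N < n then shift_coeff v * (poly (newton_poly A p m) (qnode A p (Suc N))
        - poly (newton_poly A p m) (qnode A p N)) else 0) = s * half_term (A * p ^ k) v"
    proof (cases "N < n")
      case True
      have "qnode A p (Suc N) = joukowski (p * v)" by (simp add: qnode_def v_def mult_ac)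
      then show ?thesis
        using True shift_coeff_diff[of v k] v s0 s1 by (simp add: node Suc s_def v_def)
    next
      case False
      with N AD have "D * v = 1" by (simp add: v_def mult_ac)
      then have "half_term (A * p ^ k) v = 0" by (simp add: half_term_def)
      with False show ?thesis by simp
    qed
    have down: "(if 0 < N then shift_coeff (inverse v) * (poly (newton_poly A p m) (qnode A p (N - 1))
        - poly (newton_poly A p m) (qnode A p N)) else 0) = s * half_term (A * p ^ k) (inverse v)"
    proof (cases "0 < N")
      case True
      have iv: "inverse v \<noteq> 0" "(inverse v)\<^sup>2 \<noteq> 1" "p * (inverse v)\<^sup>2 \<noteq> 1"
        using v s0 s2[OF True] by (auto simp: field_simps v_def)
      have "p * inverse v = inverse (A * p ^ (N - 1))"
        using True p_nz by (cases N) (auto simp: v_def)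
      then have "joukowski (p * inverse v) = qnode A p (N - 1)"
        unfolding qnode_def by (metis joukowski_inverse)
      then show ?thesis
        using True shift_coeff_diff[OF iv, of k] by (simp add: node Suc s_def)
    next
      case False
      \<comment> \<open>Here \<open>v = A\<close>. For \<open>k = 0\<close> the first factor of
        \<open>half_term\<close> is zero; for \<open>k > 0\<close> node 0 is a root of the Newton
        polynomial inside \<open>s\<close>.\<close>
      have "s * half_term (A * p ^ k) (inverse v) = 0"
      proof (cases k)
        case 0
        with False v show ?thesis by (simp add: half_term_def v_def)
      next
        case (Suc i)
        have "poly (newton_poly A p k) (joukowski v) = 0"
          unfolding node[symmetric] using False Suc by (intro poly_newton_poly_node) simp
        then show ?thesis by (simp add: s_def)
      qed
      with False show ?thesis by simp
    qed
    have "poly (image_poly m) (qnode A p N) = (E0 + E1 * qnode A p N) * poly (newton_poly A p m) (qnode A p N)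
        + s * (half_term (A * p ^ k) v + half_term (A * p ^ k) (inverse v))"
      using top half_term_symm[of v "A * p ^ k"] v s0
      by (simp add: poly_image_poly Suc s_def node v_def)
    then show ?thesis
      unfolding lattice_op_def v_def[symmetric] up down by (simp add: algebra_simps)
  qed
qed

text \<open>Linearity over the Newton expansion. Since the top coefficient of a monic polynomial is
  1, the subtracted term is \<open>c0\<close> times one fixed polynomial, whatever the points
  \<open>V i\<close> are; on the nodes that term vanishes.\<close>

lemma monic_image:
  fixes V :: "'i \<Rightarrow> complex"
  assumes S: "finite S" "card S = n"
    and nodes: "\<And>N. N \<le> n \<Longrightarrow> (A * p ^ N)\<^sup>2 \<noteq> 1" "\<And>N. N < n \<Longrightarrow> p * (A * p ^ N)\<^sup>2 \<noteq> 1"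
      "\<And>N. 0 < N \<Longrightarrow> N \<le> n \<Longrightarrow> (A * p ^ N)\<^sup>2 \<noteq> p"
  defines "f \<equiv> \<lambda>x. \<Prod>i\<in>S. x - V i"
  obtains h where "degree h \<le> n"
    "\<And>v. v \<noteq> 0 \<Longrightarrow> v\<^sup>2 \<noteq> 1 \<Longrightarrow> p * v\<^sup>2 \<noteq> 1 \<Longrightarrow> v\<^sup>2 \<noteq> p \<Longrightarrow> poly h (joukowski v) =
      shift_coeff v * (f (joukowski (p * v)) - f (joukowski v))
      + shift_coeff (inverse v) * (f (joukowski (v / p)) - f (joukowski v))
      + (E0 + E1 * joukowski v) * f (joukowski v)
      - c0 * poly (newton_poly A p (Suc n)) (joukowski v)"
    "\<And>N. N \<le> n \<Longrightarrow> poly h (qnode A p N) =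
      lattice_op n (\<lambda>N. shift_coeff (A * p ^ N)) (\<lambda>N. shift_coeff (inverse (A * p ^ N)))
        (\<lambda>N. E0 + E1 * qnode A p N) (\<lambda>N. f (qnode A p N)) N"
proof -
  obtain c where cn: "c n = 1" and c: "(\<Prod>i\<in>S. [:- V i, 1:]) = (\<Sum>k\<le>n. smult (c k) (newton_poly A p k))"
    using newton_poly_span[OF S(1), of V A p] S(2) by auto
  have f: "f x = (\<Sum>k\<le>n. c k * poly (newton_poly A p k) x)" for x
  proof -
    have "f x = poly (\<Prod>i\<in>S. [:- V i, 1:]) x" by (simp add: f_def poly_prod)
    also have "\<dots> = (\<Sum>k\<le>n. c k * poly (newton_poly A p k) x)" by (simp add: c poly_sum)
    finally show ?thesis .
  qed
  define h where "h = (\<Sum>k\<le>n. smult (c k) (image_poly k))"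
  have h: "poly h x = (\<Sum>k\<le>n. c k * poly (image_poly k) x)" for x
    by (simp add: h_def poly_sum)
  show thesis
  proof (rule that[of h])
    show "degree h \<le> n" unfolding h_def
      using degree_image_poly by (auto intro!: degree_sum_le order_trans[OF degree_smult_le])
  next
    fix v :: complex
    assume v: "v \<noteq> 0" "v\<^sup>2 \<noteq> 1" "p * v\<^sup>2 \<noteq> 1" "v\<^sup>2 \<noteq> p"
    have "(\<Sum>k\<le>n. c k * (if k = n then c0 else 0)) = c0"
      using cn by (simp add: if_distrib sum.delta' cong: if_cong)
    then have top: "(\<Sum>k\<le>n. c k * ((if k = n then c0 else 0) * z)) = c0 * z" for z
      by (simp add: mult.assoc[symmetric] sum_distrib_right[symmetric])
    show "poly h (joukowski v) = shift_coeff v * (f (joukowski (p * v)) - f (joukowski v))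
      + shift_coeff (inverse v) * (f (joukowski (v / p)) - f (joukowski v))
      + (E0 + E1 * joukowski v) * f (joukowski v)
      - c0 * poly (newton_poly A p (Suc n)) (joukowski v)"
      unfolding h image_poly_generic[OF v] f top[symmetric]
      by (simp only: sum_subtractf[symmetric] sum_distrib_left sum.distrib[symmetric])
        (rule sum.cong[OF refl], simp only: algebra_simps)
  next
    fix N assume N: "N \<le> n"
    show "poly h (qnode A p N) =
      lattice_op n (\<lambda>N. shift_coeff (A * p ^ N)) (\<lambda>N. shift_coeff (inverse (A * p ^ N)))
        (\<lambda>N. E0 + E1 * qnode A p N) (\<lambda>N. f (qnode A p N)) N"
    proof -
      have "poly h (qnode A p N) = (\<Sum>k\<le>n. c k * lattice_op n (\<lambda>N. shift_coeff (A * p ^ N))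
          (\<lambda>N. shift_coeff (inverse (A * p ^ N))) (\<lambda>N. E0 + E1 * qnode A p N)
          (\<lambda>N. poly (newton_poly A p k) (qnode A p N)) N)"
        unfolding h using N nodes by (intro sum.cong refl) (simp add: image_poly_node)
      also have "\<dots> = lattice_op n (\<lambda>N. shift_coeff (A * p ^ N)) (\<lambda>N. shift_coeff (inverse (A * p ^ N)))
        (\<lambda>N. E0 + E1 * qnode A p N) (\<lambda>N. f (qnode A p N)) N"
        unfolding lattice_op_def f
        by (simp add: sum_distrib_left sum.distrib[symmetric] sum_subtractf[symmetric] algebra_simps)
      finally show ?thesis .
    qed
  qed
qed

end

section \<open>The \<open>q\<close>-Racah lattice\<close>

text \<open>Summation by parts: by \<open>bal\<close> the difference of the summands telescopes
  through the Casoratian \<open>S\<close>, and the diagonal terms cancel.\<close>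

lemma lattice_op_selfadjoint:
  assumes bal: "\<And>N. N < n \<Longrightarrow> k N * u N = k (Suc N) * w (Suc N)"
  shows "(\<Sum>N\<le>n. k N * (g N * lattice_op n u w E f N)) = (\<Sum>N\<le>n. k N * (f N * lattice_op n u w E g N))"
proof -
  define S where "S N = k N * u N * (f (Suc N) * g N - f N * g (Suc N))" for N
  have "k N * (g N * lattice_op n u w E f N) - k N * (f N * lattice_op n u w E g N) =
      (if N < n then S N else 0) - (if 0 < N then S (N - 1) else 0)" if "N \<le> n" for N
  proof -
    have "k N * w N * (g N * f (N - 1) - f N * g (N - 1)) = - S (N - 1)" if "0 < N"
      using that bal[of "N - 1"] \<open>N \<le> n\<close> by (cases N) (auto simp: S_def algebra_simps)
    then have "0 < N \<Longrightarrow> S (N - 1) = - (k N * w N * (g N * f (N - 1) - f N * g (N - 1)))" by simp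
    then show ?thesis unfolding lattice_op_def S_def[of N]
      by (auto simp: algebra_simps)
  qed
  then have "(\<Sum>N\<le>n. k N * (g N * lattice_op n u w E f N)) - (\<Sum>N\<le>n. k N * (f N * lattice_op n u w E g N))
      = (\<Sum>N\<le>n. if N < n then S N else 0) - (\<Sum>N\<le>n. if 0 < N then S (N - 1) else 0)"
    by (simp add: sum_subtractf[symmetric])
  also have "(\<Sum>N\<le>n. if N < n then S N else 0) = (\<Sum>N<n. S N)"
    by (intro sum.mono_neutral_cong_right) auto
  also have "(\<Sum>N\<le>n. if 0 < N then S (N - 1) else 0) = (\<Sum>N<n. S N)"
    by (subst sum.atMost_shift) simp
  finally show ?thesis by simp
qed

text \<open>\<open>A2\<close> keeps the nodes off the poles. \<open>AB\<close> and \<open>AC\<close>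
  serve the denominators of the series, \<open>AdB\<close> and \<open>AdC\<close> those of the
  weight; \<open>AB\<close> and \<open>AdB\<close> also make the gauge invertible.\<close>

locale qracah =
  fixes p A B C D \<gamma> :: complex and n :: nat
  assumes nz: "p \<noteq> 0" "A \<noteq> 0" "B \<noteq> 0" "C \<noteq> 0" "\<gamma> \<noteq> 0"
    and AD: "A * D * p ^ n = 1"
    and p_nru: "\<And>m. 0 < m \<Longrightarrow> p ^ m \<noteq> 1"
    and A2: "\<And>m. m \<le> 2 * n \<Longrightarrow> A\<^sup>2 * p ^ m \<noteq> 1"
    and AB: "\<And>m. m < n \<Longrightarrow> A * B * p ^ m \<noteq> 1"
    and AC: "\<And>m. m < n \<Longrightarrow> A * C * p ^ m \<noteq> 1"
    and AdB: "\<And>m. m < n \<Longrightarrow> A * p ^ Suc m / B \<noteq> 1"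
    and AdC: "\<And>m. m < n \<Longrightarrow> A * p ^ Suc m / C \<noteq> 1"
begin

lemma D_eq: "D = inverse (A * p ^ n)"
  using AD nz by (simp add: field_simps)

lemma AD_ne:
  assumes "m < n"
  shows "A * D * p ^ m \<noteq> 1"
proof
  assume "A * D * p ^ m = 1"
  then have "A * D * p ^ m * p ^ (n - m) = p ^ (n - m)" by simp
  moreover have "p ^ m * p ^ (n - m) = p ^ n" using assms by (simp flip: power_add)
  ultimately have "p ^ (n - m) = 1" using AD by (simp add: mult.assoc)
  with p_nru[of "n - m"] assms show False by simp
qed

lemma node_ne:
  shows "N \<le> n \<Longrightarrow> (A * p ^ N)\<^sup>2 \<noteq> 1"
    and "N < n \<Longrightarrow> p * (A * p ^ N)\<^sup>2 \<noteq> 1"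
    and "0 < N \<Longrightarrow> N \<le> n \<Longrightarrow> (A * p ^ N)\<^sup>2 \<noteq> p"
proof -
  have sq: "(A * p ^ N)\<^sup>2 = A\<^sup>2 * p ^ (2 * N)" by (simp add: power_mult_distrib power_mult[symmetric] mult.commute)
  show "N \<le> n \<Longrightarrow> (A * p ^ N)\<^sup>2 \<noteq> 1" using A2[of "2 * N"] sq by simp
  show "N < n \<Longrightarrow> p * (A * p ^ N)\<^sup>2 \<noteq> 1" using A2[of "Suc (2 * N)"] sq by (simp add: mult_ac)
  show "(A * p ^ N)\<^sup>2 \<noteq> p" if N: "0 < N" "N \<le> n"
  proof
    assume *: "(A * p ^ N)\<^sup>2 = p"
    obtain k where k: "N = Suc k" using N by (cases N) auto
    have "A\<^sup>2 * p ^ Suc (2 * k) * p = 1 * p"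
      using * sq by (simp add: k mult_ac)
    then show False using A2[of "Suc (2 * k)"] N nz by (simp add: k)
  qed
qed

definition Eh :: complex where "Eh = \<gamma> * (1 + A * B * C * D / p)"
definition Ei :: complex where "Ei = Eh + \<gamma> * B / p * (A + C + D - A * C * D)"
definition Bp :: complex where "Bp = - (B / p)"

text \<open>The fourth factor is 1 - B v in \<open>hom\<close>, for epsilon = -, and 1 - B / (p v)
  in \<open>inhom\<close>, for epsilon = +. In \<open>unit\<close> it is 1; that instance only
  expresses the difference of the other two.\<close>

sublocale hom: aw_operator p A C D \<gamma> 1 "- B" 0 Eh 0 0 n
  by unfold_locales (use nz AD in auto)

sublocale inhom: aw_operator p A C D \<gamma> 1 0 Bp Ei "\<gamma> * Bp" "\<gamma> * Bp / p ^ n" n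
  by unfold_locales (use nz AD in \<open>auto simp: field_simps\<close>)

sublocale unit: aw_operator p A C D \<gamma> 1 0 0 0 0 0 n
  by unfold_locales (use nz AD in auto)

definition eigen :: "nat \<Rightarrow> complex" where
  "eigen m = \<gamma> / p ^ m + \<gamma> * (A * B * C * D / p) * p ^ m"

definition lower :: "nat \<Rightarrow> complex" where
  "lower m = \<gamma> * (1 - p ^ Suc m) * (1 - A * B * p ^ m) * (1 - A * C * p ^ m) * (1 - A * D * p ^ m) / (A * p ^ m * p ^ Suc m)"

lemma poly_hom_image_0: "poly (hom.image_poly 0) x = eigen 0"
  unfolding hom.poly_image_poly by (simp add: eigen_def Eh_def algebra_simps)

text \<open>With \<open>l2 = 0\<close> the symmetrized polynomial is linear. Expanding it around
  node \<open>m\<close>, where its value is \<open>t\<close>, makes the operator bidiagonal in the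
  Newton basis.\<close>

lemma poly_hom_image_Suc:
  "poly (hom.image_poly (Suc m)) x = eigen (Suc m) * poly (newton_poly A p (Suc m)) x
     + lower m * poly (newton_poly A p m) x"
proof -
  define X where "X = A * p ^ m"
  have X: "X \<noteq> 0" using nz by (simp add: X_def)
  define F where "F = poly (newton_poly A p m) x"
  define s where "s = \<gamma> * (1 - p ^ Suc m) / p ^ Suc m"
  define t where "t = (1 - B * X) * (1 - C * X) * (1 - D * X) / X"
  define w where "w = 1 - B * C * D * X"
  have T: "poly (hom.symm_poly X) x = w * (x - qnode A p m) + t"
    using X by (simp add: hom.symm_poly_def Let_def qnode_def joukowski_def X_def[symmetric] t_def w_def divide_simps)
      (simp add: algebra_simps)
  have F': "poly (newton_poly A p (Suc m)) x = (x - qnode A p m) * F"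
    by (simp add: poly_newton_poly_Suc F_def)
  have e: "eigen (Suc m) = Eh + s * w"
    using nz by (simp add: eigen_def Eh_def X_def s_def w_def field_simps)
  have l: "lower m = s * t"
    by (simp add: lower_def X_def s_def t_def mult_ac)
  show ?thesis
    unfolding hom.poly_image_poly diff_Suc_1 X_def[symmetric] T F' F_def[symmetric] e l s_def[symmetric]
    by (simp add: algebra_simps)
qed

section \<open>Eigenfunctions as terminating series\<close>

definition coef :: "nat \<Rightarrow> nat \<Rightarrow> complex" where
  "coef M m = (\<Prod>k<m. - (A * p ^ k) * p * (1 - p ^ k / p ^ M) * (1 - A * B * C * D / p * p ^ (M + k))
     / ((1 - p ^ Suc k) * (1 - A * B * p ^ k) * (1 - A * C * p ^ k) * (1 - A * D * p ^ k)))"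

definition eigfun :: "nat \<Rightarrow> nat \<Rightarrow> complex" where
  "eigfun M N = (\<Sum>m\<le>n. coef M m * poly (newton_poly A p m) (qnode A p N))"

text \<open>This two-term recurrence is the eigenvector equation of the bidiagonal matrix with
  diagonal \<open>eigen\<close> and off-diagonal \<open>lower\<close>; the two middle factors of
  \<open>coef\<close> come from factoring \<open>eigen M - eigen m\<close>.\<close>

lemma coef_Suc:
  assumes "m < n"
  shows "coef M (Suc m) * lower m = (eigen M - eigen m) * coef M m"
proof -
  define P Q where "P = p ^ m" and "Q = p ^ M"
  define t where "t = A * B * C * D / p"
  define d where "d = (1 - p * P) * (1 - A * B * P) * (1 - A * C * P) * (1 - A * D * P)"
  have PQ: "P \<noteq> 0" "Q \<noteq> 0" using nz by (auto simp: P_def Q_def)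
  have d: "d \<noteq> 0"
    using p_nru[of "Suc m"] AB[OF assms] AC[OF assms] AD_ne[OF assms] by (simp add: d_def P_def)
  have "coef M (Suc m) = coef M m * (- (A * P) * p * (1 - P / Q) * (1 - t * (Q * P)) / d)"
    by (simp add: coef_def P_def Q_def d_def t_def power_add)
  moreover have "lower m = \<gamma> * d / (A * P * (p * P))"
    by (simp add: lower_def d_def P_def mult_ac)
  ultimately have "coef M (Suc m) * lower m
      = coef M m * (- (A * P) * p * (1 - P / Q) * (1 - t * (Q * P)) * \<gamma> / (A * P * (p * P)))"
    using d by simp
  also have "- (A * P) * p * (1 - P / Q) * (1 - t * (Q * P)) * \<gamma> / (A * P * (p * P))
      = - (\<gamma> / P * (1 - P / Q) * (1 - t * (Q * P)))"
    using PQ nz by simp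
  also have "\<dots> = eigen M - eigen m"
    unfolding eigen_def P_def[symmetric] Q_def[symmetric] t_def[symmetric]
    using PQ by (simp add: field_simps)
  finally show ?thesis by (simp add: mult.commute)
qed

abbreviation "up_h N \<equiv> hom.shift_coeff (A * p ^ N)"
abbreviation "down_h N \<equiv> hom.shift_coeff (inverse (A * p ^ N))"
abbreviation "up_i N \<equiv> inhom.shift_coeff (A * p ^ N)"
abbreviation "down_i N \<equiv> inhom.shift_coeff (inverse (A * p ^ N))"
abbreviation "const_h N \<equiv> Eh + 0 * qnode A p N"
abbreviation "const_i N \<equiv> Ei + \<gamma> * Bp * qnode A p N"

lemma lattice_op_sum:
  assumes "finite S"
  shows "lattice_op n u w E (\<lambda>N. \<Sum>m\<in>S. c m * f m N) N = (\<Sum>m\<in>S. c m * lattice_op n u w E (f m) N)"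
  unfolding lattice_op_def
  by (simp add: sum_distrib_left sum.distrib[symmetric] sum_subtractf[symmetric] algebra_simps)

text \<open>By \<open>coef_Suc\<close> the terms moved down by \<open>lower\<close> supply exactly
  the defect \<open>eigen M - eigen m\<close> of the diagonal terms.\<close>

lemma eigfun_eigen:
  assumes M: "M \<le> n" and N: "N \<le> n"
  shows "lattice_op n up_h down_h const_h (eigfun M) N = eigen M * eigfun M N"
proof -
  define F where "F m = poly (newton_poly A p m) (qnode A p N)" for m
  have "lattice_op n up_h down_h const_h (eigfun M) N = (\<Sum>m\<le>n. coef M m * poly (hom.image_poly m) (qnode A p N))"
    unfolding eigfun_def lattice_op_sum[OF finite_atMost]
    using N node_ne by (intro sum.cong refl) (subst hom.image_poly_node, auto)
  also have "\<dots> = coef M 0 * eigen 0 * F 0 + (\<Sum>m<n. coef M (Suc m) * eigen (Suc m) * F (Suc m) + coef M (Suc m) * lower m * F m)"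
    unfolding sum.atMost_shift poly_hom_image_Suc poly_hom_image_0 F_def by (simp add: algebra_simps)
  also have "\<dots> = (\<Sum>m\<le>n. coef M m * eigen m * F m) + (\<Sum>m<n. coef M (Suc m) * lower m * F m)"
    unfolding sum.atMost_shift by (simp add: sum.distrib)
  also have "(\<Sum>m<n. coef M (Suc m) * lower m * F m) = (\<Sum>m<n. (eigen M - eigen m) * coef M m * F m)"
    by (intro sum.cong refl) (simp add: coef_Suc)
  also have "\<dots> = (\<Sum>m\<le>n. (eigen M - eigen m) * coef M m * F m)"
  proof -
    \<comment> \<open>The sum may be extended to \<open>m = n\<close>: either \<open>M = n\<close>,
      or the product \<open>coef M n\<close> contains the zero factor at
      \<open>k = M\<close>.\<close>
    have "(eigen M - eigen n) * coef M n = 0"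
    proof (cases "M = n")
      case False
      then have "coef M n = 0" unfolding coef_def using M nz by (intro prod_zero) (auto intro!: bexI[of _ M])
      then show ?thesis by simp
    qed simp
    then show ?thesis by (simp add: lessThan_Suc_atMost[symmetric])
  qed
  also have "(\<Sum>m\<le>n. coef M m * eigen m * F m) + (\<Sum>m\<le>n. (eigen M - eigen m) * coef M m * F m)
      = eigen M * eigfun M N"
    unfolding eigfun_def F_def by (simp add: sum.distrib[symmetric] sum_distrib_left algebra_simps)
  finally show ?thesis .
qed

section \<open>The weight and detailed balance\<close>

definition weight :: "nat \<Rightarrow> complex" where
  "weight N = (\<Prod>k<N. (1 - A * B * p ^ k) * (1 - A * C * p ^ k) * (1 - A\<^sup>2 * p ^ k) * (1 - A * D * p ^ k)
     / ((1 - p ^ Suc k) * (1 - A * p ^ Suc k / C) * (1 - A * p ^ Suc k / B) * (1 - A\<^sup>2 * p ^ (n + Suc k))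
        * (A * B * C * D / p))) * ((1 - A\<^sup>2 * p ^ (2 * N)) / (1 - A\<^sup>2))"

definition gauge :: "nat \<Rightarrow> complex" where
  "gauge N = (\<Prod>k<N. (1 - A * B * p ^ k) / (1 - B / (A * p ^ Suc k)))"

lemma D_nz: "D \<noteq> 0"
  using AD by auto

text \<open>The numerators of the weight ratio are the factors of \<open>up_h\<close>. Those of
  \<open>down_h\<close> at \<open>inverse (p * w)\<close>, rewritten through
  \<open>1 - p * w / x\<close> for each parameter \<open>x\<close>, give \<open>den\<close>, and
  their prefactors multiply to \<open>t\<close>.\<close>

lemma weight_balance:
  assumes N: "N < n"
  shows "weight N * up_h N = weight (Suc N) * down_h (Suc N)"
proof -
  define P w t where "P = p ^ N" and "w = A * P" and "t = A * B * C * D / p"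
  define num where "num = (1 - B * w) * (1 - C * w) * (1 - A * w) * (1 - D * w)"
  define den where "den = (1 - p * P) * (1 - p * w / C) * (1 - p * w / B) * (1 - p * w / D)"
  define K where "K = (\<Prod>k<N. (1 - A * B * p ^ k) * (1 - A * C * p ^ k) * (1 - A\<^sup>2 * p ^ k) * (1 - A * D * p ^ k)
     / ((1 - p ^ Suc k) * (1 - A * p ^ Suc k / C) * (1 - A * p ^ Suc k / B) * (1 - A\<^sup>2 * p ^ (n + Suc k)) * t))
     / (1 - A\<^sup>2)"
  have w0: "w \<noteq> 0" "P \<noteq> 0" "t \<noteq> 0" using nz D_nz by (auto simp: w_def P_def t_def)
  have w2: "w\<^sup>2 = A\<^sup>2 * p ^ (2 * N)"
    by (simp add: w_def P_def power_mult_distrib power_mult[symmetric] mult.commute)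
  \<comment> \<open>The factor of \<open>weight\<close> containing \<open>n\<close> is the one that
    belongs to \<open>D\<close>, by the truncation condition.\<close>
  have wD: "p * w / D = A\<^sup>2 * p ^ (n + Suc N)"
    using nz by (simp add: D_eq w_def P_def power_add power2_eq_square divide_inverse mult_ac)
  have den: "den \<noteq> 0"
  proof -
    have "1 - p * P \<noteq> 0" using p_nru[of "Suc N"] by (simp add: P_def)
    moreover have "1 - p * w / C \<noteq> 0" "1 - p * w / B \<noteq> 0"
      using AdC[OF N] AdB[OF N] by (simp_all add: w_def P_def mult_ac)
    moreover have "1 - p * w / D \<noteq> 0"
      using A2[of "n + Suc N"] N unfolding wD by simp
    ultimately show ?thesis by (simp add: den_def)
  qed
  have s: "1 - w\<^sup>2 \<noteq> 0" "1 - p * w\<^sup>2 \<noteq> 0" "1 - (p * w)\<^sup>2 \<noteq> 0"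
    using node_ne(1)[of N] node_ne(1)[of "Suc N"] node_ne(2)[of N] N
    by (auto simp: w_def P_def mult_ac)
  have WN: "weight N = K * (1 - w\<^sup>2)"
    by (simp add: weight_def K_def w2 t_def)
  have WS: "weight (Suc N) = K * (num / (den * t)) * (1 - (p * w)\<^sup>2)"
  proof -
    have "A\<^sup>2 * p ^ (2 * Suc N) = (p * w)\<^sup>2" using w2 by (simp add: power_mult_distrib power2_eq_square)
    moreover have "(1 - A * B * p ^ N) * (1 - A * C * p ^ N) * (1 - A\<^sup>2 * p ^ N) * (1 - A * D * p ^ N) = num"
      by (simp add: num_def w_def P_def power2_eq_square mult_ac)
    moreover have "(1 - p ^ Suc N) * (1 - A * p ^ Suc N / C) * (1 - A * p ^ Suc N / B) * (1 - A\<^sup>2 * p ^ (n + Suc N)) = den"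
      unfolding den_def wD by (simp add: w_def P_def mult_ac)
    ultimately show ?thesis
      unfolding weight_def K_def t_def[symmetric] by (simp only: prod.lessThan_Suc times_divide_eq_left times_divide_eq_right)
        (simp add: mult_ac)
  qed
  have U: "up_h N = \<gamma> * num / ((1 - w\<^sup>2) * (1 - p * w\<^sup>2))"
    by (simp add: hom.shift_coeff_def w_def P_def num_def mult_ac)
  have Dn: "down_h (Suc N) = \<gamma> * t * den / ((1 - p * w\<^sup>2) * (1 - (p * w)\<^sup>2))"
  proof -
    have iv: "inverse (A * p ^ Suc N) = inverse (p * w)" by (simp add: w_def P_def mult_ac)
    have f: "1 - x * inverse (p * w) = - (x / (p * w)) * (1 - p * w / x)" if "x \<noteq> 0" for x
      using that w0 nz by (simp add: field_simps)
    have a: "p * w / A = p * P" using nz by (simp add: w_def)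
    have g: "1 - (inverse (p * w))\<^sup>2 = - (1 - (p * w)\<^sup>2) / (p * w)\<^sup>2"
      "1 - p * (inverse (p * w))\<^sup>2 = - (1 - p * w\<^sup>2) / (p * w\<^sup>2)"
      using w0 nz by (simp_all add: field_simps power2_eq_square)
    have "down_h (Suc N) = \<gamma> * (1 - A * inverse (p * w)) * (1 - C * inverse (p * w)) * (1 - D * inverse (p * w))
        * (1 - B * inverse (p * w)) / ((1 - (inverse (p * w))\<^sup>2) * (1 - p * (inverse (p * w))\<^sup>2))"
      unfolding hom.shift_coeff_def iv by simp
    also have "\<dots> = \<gamma> * t * den / ((1 - p * w\<^sup>2) * (1 - (p * w)\<^sup>2))"
    proof -
      have gen: "\<gamma> * (- (A / z) * a1) * (- (C / z) * a2) * (- (D / z) * a3) * (- (B / z) * a4) / (- s1 / z\<^sup>2 * (- s2 / y))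
          = \<gamma> * (A * B * C * D * y / z\<^sup>2) * (a1 * a2 * a4 * a3) / (s2 * s1)"
        if "z \<noteq> 0" "y \<noteq> 0" "s1 \<noteq> 0" "s2 \<noteq> 0" for a1 a2 a3 a4 s1 s2 z y
        using that by (simp add: divide_simps power2_eq_square)
      have "A * B * C * D * (p * w\<^sup>2) / (p * w)\<^sup>2 = t"
        using w0 nz by (simp add: t_def divide_simps power2_eq_square)
      then show ?thesis
        unfolding f[OF nz(2)] f[OF nz(3)] f[OF nz(4)] f[OF D_nz] g a den_def
        using w0 nz s by (subst gen) auto
    qed
    finally show ?thesis .
  qed
  show ?thesis unfolding WN WS U Dn using s den w0 by (simp add: divide_simps)
qed

text \<open>Self-adjointness moves the operator onto the eigenfunction: weight times eigenfunction
  is a left eigenvector on the lattice.\<close>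

lemma hom_lattice_sum:
  assumes "M \<le> n"
  shows "(\<Sum>N\<le>n. weight N * eigfun M N * lattice_op n up_h down_h const_h f N)
    = eigen M * (\<Sum>N\<le>n. weight N * eigfun M N * f N)"
proof -
  have "(\<Sum>N\<le>n. weight N * eigfun M N * lattice_op n up_h down_h const_h f N) =
      (\<Sum>N\<le>n. weight N * (f N * lattice_op n up_h down_h const_h (eigfun M) N))"
    using lattice_op_selfadjoint[of n weight up_h down_h "eigfun M" const_h f] weight_balance
    by (simp add: mult.assoc)
  also have "\<dots> = eigen M * (\<Sum>N\<le>n. weight N * eigfun M N * f N)"
    unfolding sum_distrib_left using assms
    by (intro sum.cong refl) (simp only: eigfun_eigen atMost_iff mult_ac)
  finally show ?thesis .
qed

section \<open>Conjugation of the two operators by the gauge\<close>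

lemma gauge_factor:
  assumes "m < n"
  shows "1 - A * B * p ^ m \<noteq> 0" "1 - B / (A * p ^ Suc m) \<noteq> 0"
  using AB[OF assms] AdB[OF assms] nz by (auto simp: field_simps)

lemma gauge_nz:
  assumes "N \<le> n"
  shows "gauge N \<noteq> 0"
proof -
  have "(1 - A * B * p ^ k) / (1 - B / (A * p ^ Suc k)) \<noteq> 0" if "k < N" for k
    using gauge_factor[of k] that assms unfolding divide_eq_0_iff by simp
  then show ?thesis unfolding gauge_def by (simp del: power_Suc divide_eq_0_iff)
qed

lemma gauge_Suc: "gauge (Suc N) = gauge N * ((1 - A * B * p ^ N) / (1 - B / (A * p ^ Suc N)))"
  by (simp add: gauge_def)

text \<open>The two shift coefficients differ by a term without the pole at \<open>p v\<^sup>2 = 1\<close>, so the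
  comparison survives at the end nodes, where that pole may be present.\<close>
lemma shift_coeff_hom_inhom:
  assumes "v \<noteq> 0" "v\<^sup>2 \<noteq> 1" "p * v\<^sup>2 \<noteq> 1"
  shows "hom.shift_coeff v - inhom.shift_coeff v = - \<gamma> * Bp * unit.half_term A v"
proof -
  have nz': "1 - v\<^sup>2 \<noteq> 0" "1 - p * v\<^sup>2 \<noteq> 0" using assms by auto
  define K where "K = (1 - A * v) * (1 - C * v) * (1 - D * v)"
  have "hom.shift_coeff v - inhom.shift_coeff v = \<gamma> * K * (- B * v - Bp / v) / ((1 - v\<^sup>2) * (1 - p * v\<^sup>2))"
    unfolding hom.shift_coeff_def inhom.shift_coeff_def K_def diff_divide_distrib[symmetric]
    by (simp add: algebra_simps)
  also have "- B * v - Bp / v = - Bp * (1 - p * v\<^sup>2) / v"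
    using assms nz by (simp add: Bp_def field_simps power2_eq_square)
  finally show ?thesis
    using nz' assms by (simp add: unit.half_term_def K_def)
qed

text \<open>This identity determines \<open>Ei\<close>. Together with
  \<open>shift_coeff_hom_inhom\<close> at \<open>v\<close> and at \<open>inverse v\<close> it says
  that both operators have the same total diagonal coefficient.\<close>

lemma const_hom_inhom:
  assumes "v \<noteq> 0" "v\<^sup>2 \<noteq> 1"
  shows "Eh - (Ei + \<gamma> * Bp * joukowski v) = - \<gamma> * Bp * (unit.half_term A v + unit.half_term A (inverse v))"
  unfolding unit.half_term_symm[OF assms]
  by (simp add: unit.symm_poly_def Let_def Ei_def Bp_def algebra_simps)

text \<open>The diagonals agree, and \<open>gauge\<close> accumulates the ratios of the off-diagonal
  coefficients. The difference of the constants is split into \<open>gu\<close> and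
  \<open>gd\<close>, one for each direction, because at an end node the part for the missing
  neighbour is zero.\<close>

lemma inhom_lattice_op:
  assumes N: "N \<le> n"
  shows "lattice_op n up_i down_i const_i f N = gauge N * lattice_op n up_h down_h const_h (\<lambda>k. f k / gauge k) N"
proof -
  define v where "v = A * p ^ N"
  have v: "v \<noteq> 0" "v\<^sup>2 \<noteq> 1" using nz node_ne(1)[OF N] by (auto simp: v_def)
  have gN: "gauge N \<noteq> 0" using gauge_nz N by blast
  define gu where "gu = - \<gamma> * Bp * unit.half_term A v"
  define gd where "gd = - \<gamma> * Bp * unit.half_term A (inverse v)"
  have node: "qnode A p N = joukowski v" by (simp add: qnode_def v_def)
  have E: "const_h N - const_i N = gu + gd"
    using const_hom_inhom[OF v] by (simp add: node gu_def gd_def algebra_simps)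
  have gen: "g * h / (g * (\<alpha> / \<beta>)) = i" if "i * \<alpha> = h * \<beta>" "g \<noteq> 0" "\<alpha> \<noteq> 0" "\<beta> \<noteq> 0" for g h i \<alpha> \<beta> :: complex
    using that by (simp add: divide_simps mult.commute)
  have gen': "g * (\<alpha> / \<beta>) * h / g = i" if "i * \<beta> = h * \<alpha>" "g \<noteq> 0" "\<alpha> \<noteq> 0" "\<beta> \<noteq> 0" for g h i \<alpha> \<beta> :: complex
    using that by (simp add: divide_simps mult.commute)
  have up: "(if N < n then up_i N * (f (Suc N) - f N) else 0) =
      gauge N * (if N < n then up_h N * (f (Suc N) / gauge (Suc N) - f N / gauge N) else 0) + gu * f N"
  proof (cases "N < n")
    case True
    have "hom.shift_coeff v - inhom.shift_coeff v = gu"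
      unfolding gu_def using v node_ne(2)[OF True] by (intro shift_coeff_hom_inhom) (auto simp: v_def)
    then have 1: "up_h N - gu = up_i N" by (simp add: v_def algebra_simps)
    have "up_i N * (1 - B * v) = up_h N * (1 - B / (p * v))"
      unfolding v_def hom.shift_coeff_def inhom.shift_coeff_def by (simp add: Bp_def mult_ac)
    moreover have "1 - B * v = 1 - A * B * p ^ N" "p * v = A * p ^ Suc N"
      by (simp_all add: v_def mult_ac)
    ultimately have "up_i N * (1 - A * B * p ^ N) = up_h N * (1 - B / (A * p ^ Suc N))" by (simp only:)
    then have 2: "gauge N * up_h N / gauge (Suc N) = up_i N"
      using gen gN gauge_factor[OF True] unfolding gauge_Suc by blast
    have "gauge N * (up_h N * (f (Suc N) / gauge (Suc N) - f N / gauge N)) + gu * f N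
        = (gauge N * up_h N / gauge (Suc N)) * f (Suc N) - (up_h N - gu) * f N"
      using gN by (simp add: algebra_simps)
    then show ?thesis using True unfolding 1 2 by (simp add: algebra_simps)
  next
    case False
    with N AD have "D * v = 1" by (simp add: v_def mult_ac)
    then have "gu = 0" by (simp add: gu_def unit.half_term_def)
    with False show ?thesis by simp
  qed
  have down: "(if 0 < N then down_i N * (f (N - 1) - f N) else 0) =
      gauge N * (if 0 < N then down_h N * (f (N - 1) / gauge (N - 1) - f N / gauge N) else 0) + gd * f N"
  proof (cases N)
    case (Suc k)
    then have k: "k < n" using N by simp
    have gk: "gauge k \<noteq> 0" using gauge_nz k by simp
    have "(inverse v)\<^sup>2 \<noteq> 1" "p * (inverse v)\<^sup>2 \<noteq> 1"
      using v node_ne(3)[of N] N Suc by (auto simp: field_simps v_def)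
    then have "hom.shift_coeff (inverse v) - inhom.shift_coeff (inverse v) = gd"
      unfolding gd_def using v by (intro shift_coeff_hom_inhom) auto
    then have 1: "down_h N - gd = down_i N" by (simp add: v_def algebra_simps)
    have "down_i N * (1 - B / v) = down_h N * (1 - B * v / p)"
      unfolding v_def hom.shift_coeff_def inhom.shift_coeff_def by (simp add: Bp_def divide_inverse mult_ac)
    moreover have "B * v / p = A * B * p ^ k" using nz by (simp add: v_def Suc)
    ultimately have "down_i N * (1 - B / (A * p ^ Suc k)) = down_h N * (1 - A * B * p ^ k)"
      by (simp add: v_def Suc)
    then have 2: "gauge N * down_h N / gauge k = down_i N"
      using gen' gk gauge_factor[OF k] unfolding Suc gauge_Suc by blast
    have "gauge N * (down_h N * (f k / gauge k - f N / gauge N)) + gd * f N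
        = (gauge N * down_h N / gauge k) * f k - (down_h N - gd) * f N"
      using gN by (simp add: algebra_simps)
    then show ?thesis using Suc unfolding 1 2 by (simp add: algebra_simps)
  next
    case 0
    with v have "gd = 0" by (simp add: gd_def unit.half_term_def v_def)
    with 0 show ?thesis by simp
  qed
  have "const_i N * f N = gauge N * (const_h N * (f N / gauge N)) - (gu + gd) * f N"
    unfolding E[symmetric] using gN by (simp add: algebra_simps)
  then show ?thesis
    unfolding lattice_op_def up down by (simp add: algebra_simps)
qed

lemma inhom_lattice_sum:
  assumes "M \<le> n"
  shows "(\<Sum>N\<le>n. weight N * eigfun M N / gauge N * lattice_op n up_i down_i const_i f N)
    = eigen M * (\<Sum>N\<le>n. weight N * eigfun M N / gauge N * f N)"
proof -
  have "(\<Sum>N\<le>n. weight N * eigfun M N / gauge N * lattice_op n up_i down_i const_i f N)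
      = (\<Sum>N\<le>n. weight N * eigfun M N * lattice_op n up_h down_h const_h (\<lambda>k. f k / gauge k) N)"
  proof (intro sum.cong refl)
    fix N assume "N \<in> {..n}"
    then have N: "N \<le> n" by simp
    show "weight N * eigfun M N / gauge N * lattice_op n up_i down_i const_i f N
      = weight N * eigfun M N * lattice_op n up_h down_h const_h (\<lambda>k. f k / gauge k) N"
      unfolding inhom_lattice_op[OF N] using gauge_nz[OF N] by simp
  qed
  also have "\<dots> = eigen M * (\<Sum>N\<le>n. weight N * eigfun M N / gauge N * f N)"
    unfolding hom_lattice_sum[OF assms] by simp
  finally show ?thesis .
qed

section \<open>The common diagonal coefficient\<close>

definition diag_coeff :: "complex \<Rightarrow> complex" where
  "diag_coeff v = Eh - hom.shift_coeff v - hom.shift_coeff (inverse v)"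

lemma diag_coeff_inhom:
  assumes v: "v \<noteq> 0" "v\<^sup>2 \<noteq> 1" "p * v\<^sup>2 \<noteq> 1" "v\<^sup>2 \<noteq> p"
  shows "diag_coeff v = Ei + \<gamma> * Bp * joukowski v - inhom.shift_coeff v - inhom.shift_coeff (inverse v)"
proof -
  have iv: "inverse v \<noteq> 0" "(inverse v)\<^sup>2 \<noteq> 1" "p * (inverse v)\<^sup>2 \<noteq> 1"
    using v by (auto simp: field_simps)
  have "Eh - (Ei + \<gamma> * Bp * joukowski v) = (hom.shift_coeff v - inhom.shift_coeff v)
      + (hom.shift_coeff (inverse v) - inhom.shift_coeff (inverse v))"
    using shift_coeff_hom_inhom[OF v(1-3)] shift_coeff_hom_inhom[OF iv] const_hom_inhom[OF v(1,2)]
    by (simp only: distrib_left)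
  then show ?thesis
    unfolding diag_coeff_def by (simp add: algebra_simps)
qed

text \<open>The factor on the left clears the poles at \<open>p * v\<^sup>2 = 1\<close> and
  \<open>v\<^sup>2 = p\<close>, and those at \<open>v\<^sup>2 = 1\<close> cancel by symmetry. The
  result is linear in \<open>joukowski v\<close>, which is the shape of the eta terms in
  \<open>Lmat\<close>.\<close>

lemma diag_coeff_eq:
  assumes v: "v \<noteq> 0" "v\<^sup>2 \<noteq> 1" "p * v\<^sup>2 \<noteq> 1" "v\<^sup>2 \<noteq> p"
  shows "diag_coeff v * ((joukowski v)\<^sup>2 - (p + 2 + 1 / p)) =
    \<gamma> / p * ((p * (A + B + C + D) + (A * B * C + A * B * D + A * C * D + B * C * D)) * joukowski v
      - (p + 1) * (A * B + A * C + A * D + B * C + B * D + C * D + p + A * B * C * D / p))"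
proof -
  define W where "W = (joukowski v)\<^sup>2 - (p + 2 + 1 / p)"
  have nzs: "1 - v\<^sup>2 \<noteq> 0" "1 - p * v\<^sup>2 \<noteq> 0" "p - v\<^sup>2 \<noteq> 0" using v by auto
  have W: "W = (p - v\<^sup>2) * (1 - p * v\<^sup>2) / (p * v\<^sup>2)"
    using v nz by (simp add: W_def joukowski_def field_simps power2_eq_square)
  define K1 where "K1 = (1 - A * v) * (1 - C * v) * (1 - D * v) * (1 - B * v)"
  define K2 where "K2 = (v - A) * (v - C) * (v - D) * (v - B)"
  have 1: "hom.shift_coeff v * W = \<gamma> / p * (K1 * (p - v\<^sup>2)) / (v\<^sup>2 * (1 - v\<^sup>2))"
    unfolding W hom.shift_coeff_def K1_def using v nz nzs by (simp add: divide_simps)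
  have "hom.shift_coeff (inverse v) = \<gamma> * (K2 / v ^ 4) / ((1 - (inverse v)\<^sup>2) * (1 - p * (inverse v)\<^sup>2))"
    unfolding hom.shift_coeff_def K2_def using v by (simp add: divide_simps eval_nat_numeral)
  also have "(1 - (inverse v)\<^sup>2) * (1 - p * (inverse v)\<^sup>2) = (1 - v\<^sup>2) * (p - v\<^sup>2) / v ^ 4"
    using v by (simp add: field_simps eval_nat_numeral)
  finally have inv: "hom.shift_coeff (inverse v) = \<gamma> * K2 / ((1 - v\<^sup>2) * (p - v\<^sup>2))"
    using v by simp
  have 2: "hom.shift_coeff (inverse v) * W = \<gamma> / p * (K2 * (1 - p * v\<^sup>2)) / (v\<^sup>2 * (1 - v\<^sup>2))"
    unfolding W inv using v nz nzs by (simp add: divide_simps)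
  have EW: "Eh * W = \<gamma> / p * ((p + A * B * C * D) * (p - v\<^sup>2) * (1 - p * v\<^sup>2) / p) / v\<^sup>2"
    unfolding W Eh_def using v nz by (simp add: field_simps)
  define J where "J = joukowski v"
  define e1 e2 e3 e4 where "e1 = A + B + C + D" and "e2 = A * B + A * C + A * D + B * C + B * D + C * D"
    and "e3 = A * B * C + A * B * D + A * C * D + B * C * D" and "e4 = A * B * C * D"
  have J: "J * v = v\<^sup>2 + 1" using v by (simp add: J_def joukowski_def power2_eq_square field_simps)
  have K: "K1 = 1 - e1 * v + e2 * v\<^sup>2 - e3 * v ^ 3 + e4 * v ^ 4"
    "K2 = v ^ 4 - e1 * v ^ 3 + e2 * v\<^sup>2 - e3 * v + e4"
    unfolding K1_def K2_def e1_def e2_def e3_def e4_def by (simp_all add: eval_nat_numeral algebra_simps)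
  have "(p + e4) * (p - v\<^sup>2) * (1 - p * v\<^sup>2) * (1 - v\<^sup>2) - p * (K1 * (p - v\<^sup>2) + K2 * (1 - p * v\<^sup>2))
      = (p * (p * e1 + e3) * (v * (v\<^sup>2 + 1)) - (p + 1) * (p * e2 + p\<^sup>2 + e4) * v\<^sup>2) * (1 - v\<^sup>2)"
    unfolding K by (simp add: eval_nat_numeral algebra_simps)
  then have main: "((p + e4) * (p - v\<^sup>2) * (1 - p * v\<^sup>2) / p) / v\<^sup>2 - (K1 * (p - v\<^sup>2)) / (v\<^sup>2 * (1 - v\<^sup>2))
      - (K2 * (1 - p * v\<^sup>2)) / (v\<^sup>2 * (1 - v\<^sup>2))
      = ((p * e1 + e3) * (v * (J * v)) - (p + 1) * (e2 + p + e4 / p) * v\<^sup>2) / v\<^sup>2"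
    unfolding J using v nz nzs by (simp add: divide_simps) (simp add: eval_nat_numeral algebra_simps)
  have "diag_coeff v * W = \<gamma> / p * (((p + e4) * (p - v\<^sup>2) * (1 - p * v\<^sup>2) / p) / v\<^sup>2
      - (K1 * (p - v\<^sup>2)) / (v\<^sup>2 * (1 - v\<^sup>2)) - (K2 * (1 - p * v\<^sup>2)) / (v\<^sup>2 * (1 - v\<^sup>2)))"
    unfolding diag_coeff_def left_diff_distrib 1 2 EW e4_def[symmetric]
    by (simp only: right_diff_distrib times_divide_eq_right)
  also have "\<dots> = \<gamma> / p * ((p * e1 + e3) * J - (p + 1) * (e2 + p + e4 / p))"
    unfolding main using v by (simp add: power2_eq_square diff_divide_distrib)
  finally show ?thesis unfolding W_def J_def e1_def e2_def e3_def e4_def .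
qed

end

section \<open>The parameters of the statement\<close>

lemma qpoch_nz: "qpoch x p m \<noteq> 0 \<Longrightarrow> k < m \<Longrightarrow> x * p ^ k \<noteq> 1"
  by (auto simp: qpoch_def)

locale aw_parameters =
  fixes q r0 b c bs cs bd cd zeta :: complex and n :: nat
  assumes q_nz: "q \<noteq> 0" and q_nru: "\<And>m. 0 < m \<Longrightarrow> q ^ m \<noteq> 1"
    and par_nz: "r0 \<noteq> 0" "b \<noteq> 0" "c \<noteq> 0" "bs \<noteq> 0" "cs \<noteq> 0" "bd \<noteq> 0" "cd \<noteq> 0"
    and prods: "inverse (r0\<^sup>2) = b * c" "inverse (r0\<^sup>2) = bs * cs" "inverse (r0\<^sup>2) = bd * cd"
    and nondeg: "nondeg q n r0 b c bs cs bd cd"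
    and zeta: "zeta \<noteq> 0" "inverse (zeta\<^sup>2) = bd * r0 * q ^ n"
begin

lemma c_eq: "c = inverse (r0\<^sup>2 * b)" and cs_eq: "cs = inverse (r0\<^sup>2 * bs)" and cd_eq: "cd = inverse (r0\<^sup>2 * bd)"
  using prods par_nz by (simp_all add: field_simps)

text \<open>In the variable \<open>v = q u\<^sup>2\<close> these are the four zeros of \<open>\<Lambda>\<^sub>1\<close> for \<open>\<epsilon> = -\<close>.\<close>
definition pA :: complex where "pA = r0 * bd"
definition pB :: complex where "pB = - q * cs / c"
definition pC :: complex where "pC = - (q ^ (2 * n + 1) * b / cs)"
definition pD :: complex where "pD = inverse (pA * (q\<^sup>2) ^ n)"

lemma pABC_nz: "pA \<noteq> 0" "pB \<noteq> 0" "pC \<noteq> 0" "pD \<noteq> 0"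
  using par_nz q_nz by (auto simp: pA_def pB_def pC_def pD_def)

lemma pA2: "pA\<^sup>2 = bd / cd"
  using par_nz by (simp add: pA_def cd_eq field_simps power2_eq_square)

text \<open>The range of \<open>m\<close> is covered piecewise by \<open>nondeg\<close>:
  \<open>m = 0\<close> by the condition on \<open>1 - bd / cd\<close>, the next \<open>n\<close>
  values by the numerator of \<open>nu\<close>, the last \<open>n\<close> values by
  \<open>kt_den\<close>.\<close>

lemma pA2_ne:
  assumes "m \<le> 2 * n"
  shows "pA\<^sup>2 * (q\<^sup>2) ^ m \<noteq> 1"
proof -
  consider "m = 0" | "1 \<le> m" "m \<le> n" | "n < m" by linarith
  then show ?thesis
  proof cases
    case 1
    then show ?thesis using nondeg by (simp add: nondeg_def pA2)
  next
    case 2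
    have "qpoch (bd / cd * q\<^sup>2) (q\<^sup>2) n \<noteq> 0"
      using nondeg by (auto simp: nondeg_def nu_def)
    from qpoch_nz[OF this, of "m - 1"] 2 show ?thesis
      unfolding pA2 by (cases m) (auto simp: mult_ac)
  next
    case 3
    have "kt_den q n r0 (bd, cd) (b, c) (bs, cs) n \<noteq> 0"
      using nondeg by (auto simp: nondeg_def)
    then have "qpoch (bd / cd * q ^ (2 * n + 2)) (q\<^sup>2) n \<noteq> 0"
      by (simp add: kt_den_def)
    from qpoch_nz[OF this, of "m - (n + 1)"] 3 assms
    have "bd / cd * q ^ (2 * n + 2) * (q\<^sup>2) ^ (m - (n + 1)) \<noteq> 1" by simp
    moreover have "q ^ (2 * n + 2) = (q\<^sup>2) ^ (n + 1)" by (simp only: power_mult[symmetric]) simp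
    moreover have "(q\<^sup>2) ^ (n + 1) * (q\<^sup>2) ^ (m - (n + 1)) = (q\<^sup>2) ^ m" using 3 by (simp only: power_add[symmetric]) simp
    ultimately show ?thesis unfolding pA2 by (simp only: mult.assoc not_False_eq_True)
  qed
qed

text \<open>A dictionary for rewriting the arguments of the series and of its weight. The last
  identity, with gamma equal to \<open>c\<close>, produces the coefficient \<open>b\<close> in
  theta_M.\<close>

lemma phi_parameters:
  shows "- bd * cs / c * r0 * q = pA * pB"
    and "- b * bs / cd * r0 * q ^ (2 * n + 1) = pA * pC"
    and "q powi (- 2 * int n) = pA * pD"
    and "- c * bs / cd * r0 * q = pA * q\<^sup>2 / pB"
    and "- bd * cs / b * r0 * q powi (1 - 2 * int n) = pA * q\<^sup>2 / pC"
    and "bd / cd * q ^ (2 * n + 2) = pA * q\<^sup>2 / pD"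
    and "b / c = pA * pB * pC * pD / q\<^sup>2"
proof -
  have qi: "q powi (- 2 * int n) = inverse ((q\<^sup>2) ^ n)"
    by (simp add: power_int_minus power_int_mult)
  have qj: "q powi (1 - 2 * int n) = q * inverse ((q\<^sup>2) ^ n)"
    using q_nz by (simp add: power_int_diff power_int_mult divide_inverse)
  have qk: "q ^ (2 * n) = (q\<^sup>2) ^ n" by (simp add: power_mult)
  show "- bd * cs / c * r0 * q = pA * pB" by (simp add: pA_def pB_def)
  show "- b * bs / cd * r0 * q ^ (2 * n + 1) = pA * pC"
    unfolding pA_def pC_def using par_nz by (simp add: cs_eq cd_eq divide_simps power2_eq_square)
  show "q powi (- 2 * int n) = pA * pD"
    using pABC_nz unfolding qi by (simp add: pD_def)
  show "- c * bs / cd * r0 * q = pA * q\<^sup>2 / pB"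
    unfolding pA_def pB_def using par_nz q_nz by (simp add: c_eq cs_eq cd_eq divide_simps power2_eq_square)
  show "- bd * cs / b * r0 * q powi (1 - 2 * int n) = pA * q\<^sup>2 / pC"
    using par_nz q_nz unfolding qj by (simp add: pA_def pC_def qk divide_simps power2_eq_square)
  show "bd / cd * q ^ (2 * n + 2) = pA * q\<^sup>2 / pD"
  proof -
    have "q ^ (2 * n + 2) = (q\<^sup>2) ^ n * q\<^sup>2" by (simp only: power_add qk)
    then show ?thesis
      unfolding pA2[symmetric] pD_def by (simp add: power2_eq_square[of pA] divide_inverse)
  qed
  show "b / c = pA * pB * pC * pD / q\<^sup>2"
    unfolding pA_def pB_def pC_def pD_def using par_nz q_nz by (simp add: qk divide_simps power2_eq_square)
qed

sublocale qracah "q\<^sup>2" pA pB pC pD c n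
proof
  show "q\<^sup>2 \<noteq> 0" "pA \<noteq> 0" "pB \<noteq> 0" "pC \<noteq> 0" "c \<noteq> 0"
    using pABC_nz q_nz par_nz by auto
  show "pA * pD * (q\<^sup>2) ^ n = 1" using pABC_nz q_nz by (simp add: pD_def field_simps)
  show "(q\<^sup>2) ^ m \<noteq> 1" if "0 < m" for m
    using q_nru[of "2 * m"] that by (simp add: power_mult)
  show "pA\<^sup>2 * (q\<^sup>2) ^ m \<noteq> 1" if "m \<le> 2 * n" for m
    using pA2_ne[OF that] .
  have kt: "kt_den q n r0 (bd, cd) (b, c) (bs, cs) n \<noteq> 0"
    using nondeg by (auto simp: nondeg_def)
  have "qpoch (- bd * cs / c * r0 * q) (q\<^sup>2) n \<noteq> 0"
    using nondeg by (auto simp: nondeg_def)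
  then show "pA * pB * (q\<^sup>2) ^ m \<noteq> 1" if "m < n" for m
    unfolding phi_parameters using qpoch_nz that by blast
  have "qpoch (- b * bs / cd * r0 * q ^ (2 * n + 1)) (q\<^sup>2) n \<noteq> 0"
    using nondeg by (auto simp: nondeg_def)
  then show "pA * pC * (q\<^sup>2) ^ m \<noteq> 1" if "m < n" for m
    unfolding phi_parameters using qpoch_nz that by blast
  have "qpoch (pA * q\<^sup>2 / pB) (q\<^sup>2) n \<noteq> 0" "qpoch (pA * q\<^sup>2 / pC) (q\<^sup>2) n \<noteq> 0"
    using kt unfolding kt_den_def fst_conv snd_conv phi_parameters by auto
  from this[THEN qpoch_nz] show "pA * (q\<^sup>2) ^ Suc m / pB \<noteq> 1" "pA * (q\<^sup>2) ^ Suc m / pC \<noteq> 1" if "m < n" for m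
    using that by (simp_all add: mult.assoc)
qed

section \<open>Identification of the quantities of the statement\<close>

lemma eigen_eq: "eigen M = th q b c (2 * int M)"
proof -
  have "th q b c (2 * int M) = b * (q\<^sup>2) ^ M + c / (q\<^sup>2) ^ M"
    by (simp add: th_def power_int_minus power_int_mult divide_inverse)
  moreover have "eigen M = c / (q\<^sup>2) ^ M + c * (b / c) * (q\<^sup>2) ^ M"
    unfolding phi_parameters by (simp add: eigen_def)
  ultimately show ?thesis using par_nz by simp
qed

lemma node_eq: "qnode pA (q\<^sup>2) N = r0 * th q bd cd (2 * int N)"
proof -
  have "th q bd cd (2 * int N) = bd * (q\<^sup>2) ^ N + cd / (q\<^sup>2) ^ N"
    by (simp add: th_def power_int_minus power_int_mult divide_inverse)
  then show ?thesis
    using par_nz q_nz by (simp add: qnode_def joukowski_def pA_def cd_eq field_simps power2_eq_square)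
qed

lemma weight_eq: "ktilde q n r0 (bd, cd) (b, c) (bs, cs) N = weight N"
proof -
  have 1: "pA * (q\<^sup>2) ^ Suc k / x = pA * q\<^sup>2 / x * (q\<^sup>2) ^ k" for k x by simp
  have 2: "pA\<^sup>2 * (q\<^sup>2) ^ (n + Suc k) = pA * q\<^sup>2 / pD * (q\<^sup>2) ^ k" for k
    by (simp add: pD_def power_add power2_eq_square divide_inverse mult_ac)
  have 3: "(q\<^sup>2) ^ Suc k = q\<^sup>2 * (q\<^sup>2) ^ k" for k by simp
  have 4: "q ^ (4 * N) = (q\<^sup>2) ^ (2 * N)" by (simp only: power_mult[symmetric]) simp
  define t where "t = pA * pB * pC * pD / q\<^sup>2"
  show ?thesis
    unfolding ktilde_def kt_num_def kt_den_def fst_conv snd_conv phi_parameters weight_def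
    unfolding 1 2 3 4 pA2[symmetric] qpoch_def t_def[symmetric] prod.distrib prod_dividef
    by (simp only: prod_constant card_lessThan times_divide_eq_left times_divide_eq_right
        divide_divide_eq_left mult_ac)
qed

text \<open>The two numerator factors that contain \<open>N\<close> combine into differences of
  nodes, hence into a Newton polynomial at node \<open>N\<close>; all other factors form
  \<open>coef\<close>.\<close>

lemma eigfun_eq:
  assumes "M \<le> n" "N \<le> n"
  shows "Rfun q n r0 (bd, cd) (b, c) (bs, cs) N M = eigfun M N"
proof -
  have neg: "q powi (- 2 * int m) = inverse ((q\<^sup>2) ^ m)" for m
    by (simp add: power_int_minus power_int_mult)
  define T where "T m = qpoch (inverse ((q\<^sup>2) ^ N)) (q\<^sup>2) m * qpoch (pA\<^sup>2 * (q\<^sup>2) ^ N) (q\<^sup>2) m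
      * qpoch (inverse ((q\<^sup>2) ^ M)) (q\<^sup>2) m * qpoch (pA * pB * pC * pD / q\<^sup>2 * (q\<^sup>2) ^ M) (q\<^sup>2) m
      / (qpoch (q\<^sup>2) (q\<^sup>2) m * qpoch (pA * pB) (q\<^sup>2) m * qpoch (pA * pC) (q\<^sup>2) m * qpoch (pA * pD) (q\<^sup>2) m)
      * q ^ (2 * m)" for m
  have "Rfun q n r0 (bd, cd) (b, c) (bs, cs) N M = suminf T"
    unfolding Rfun_def fst_conv snd_conv phi_parameters pA2[symmetric] phi43_def T_def
    unfolding neg by (simp only: power_mult)
  also have "suminf T = (\<Sum>m\<le>n. T m)"
  proof (rule suminf_finite)
    \<comment> \<open>For \<open>m > n\<close> the denominator vanishes as well, but the numerator
      factor at \<open>k = N\<close> already makes the term 0.\<close>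
    fix m assume "m \<notin> {..n}"
    then have "qpoch (inverse ((q\<^sup>2) ^ N)) (q\<^sup>2) m = 0"
      unfolding qpoch_def using assms q_nz by (intro prod_zero) (auto intro!: bexI[of _ N])
    then show "T m = 0" by (simp add: T_def)
  qed simp
  also have "\<dots> = eigfun M N"
    unfolding eigfun_def
  proof (intro sum.cong refl)
    fix m
    have f: "(1 - inverse ((q\<^sup>2) ^ N) * (q\<^sup>2) ^ k) * (1 - pA\<^sup>2 * (q\<^sup>2) ^ N * (q\<^sup>2) ^ k)
        = - (pA * (q\<^sup>2) ^ k) * (qnode pA (q\<^sup>2) N - qnode pA (q\<^sup>2) k)" for k
      using pABC_nz q_nz by (simp add: qnode_def joukowski_def field_simps power2_eq_square)
    have g: "pA * pB * pC * pD / q\<^sup>2 * (q\<^sup>2) ^ M * (q\<^sup>2) ^ k = pA * pB * pC * pD / q\<^sup>2 * (q\<^sup>2) ^ (M + k)" for k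
      by (simp add: power_add)
    have pm: "q ^ (2 * m) = (\<Prod>k<m. q\<^sup>2)" by (simp add: power_mult)
    have "T m = (\<Prod>k<m. (1 - inverse ((q\<^sup>2) ^ N) * (q\<^sup>2) ^ k) * (1 - pA\<^sup>2 * (q\<^sup>2) ^ N * (q\<^sup>2) ^ k)
        * (1 - inverse ((q\<^sup>2) ^ M) * (q\<^sup>2) ^ k) * (1 - pA * pB * pC * pD / q\<^sup>2 * (q\<^sup>2) ^ M * (q\<^sup>2) ^ k)
        / ((1 - q\<^sup>2 * (q\<^sup>2) ^ k) * (1 - pA * pB * (q\<^sup>2) ^ k) * (1 - pA * pC * (q\<^sup>2) ^ k) * (1 - pA * pD * (q\<^sup>2) ^ k)) * q\<^sup>2)"
      unfolding T_def qpoch_def pm by (simp only: prod.distrib prod_dividef)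
    also have "\<dots> = coef M m * poly (newton_poly pA (q\<^sup>2) m) (qnode pA (q\<^sup>2) N)"
      unfolding coef_def poly_newton_poly prod.distrib[symmetric] f g
      by (intro prod.cong refl) (simp add: divide_inverse mult_ac)
    finally show "T m = coef M m * poly (newton_poly pA (q\<^sup>2) m) (qnode pA (q\<^sup>2) N)" .
  qed
  finally show ?thesis .
qed

lemma gauge_eq:
  assumes "N \<le> n"
  shows "Hfun q r0 b cs bd cd N = gauge N"
  unfolding Hfun_def gauge_def
proof (intro prod.cong refl)
  fix k assume "k \<in> {..<N}"
  with assms have k: "k < n" by simp
  define P where "P = (q\<^sup>2) ^ k"
  have P: "P \<noteq> 0" using q_nz by (simp add: P_def)
  have pw: "q ^ (4 * k) = P\<^sup>2" "q powi (- 2 * int k) = inverse P" "q ^ (2 * k) = P"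
    unfolding P_def by (simp_all add: power_int_minus power_int_mult flip: power_mult)
  have "cd * inverse P + r0 * q * cs * b = cd / P * (1 - pA * pB * P)"
    unfolding pA_def pB_def using par_nz P q_nz by (simp add: c_eq cd_eq field_simps power2_eq_square)
  moreover have "bd * P + r0 * inverse q * cs * b = bd * P * (1 - pB / (pA * (q\<^sup>2 * P)))"
    unfolding pA_def pB_def using par_nz P q_nz by (simp add: c_eq cd_eq field_simps power2_eq_square)
  ultimately show "q ^ (4 * k) * (bd / cd) * (cd * q powi (- 2 * int k) + r0 * q * cs * b) / (bd * q ^ (2 * k) + r0 * inverse q * cs * b)
      = (1 - pA * pB * (q\<^sup>2) ^ k) / (1 - pB / (pA * (q\<^sup>2) ^ Suc k))"
    unfolding pw P_def[symmetric] power_Suc using par_nz P by (simp add: power2_eq_square)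
qed

section \<open>The functions of u in the variable v = q u^2\<close>

definition qarg :: "complex \<Rightarrow> complex" where "qarg u = q * u\<^sup>2"

lemma q_plus_nz: "q + inverse q \<noteq> 0"
proof
  assume "q + inverse q = 0"
  then have "q\<^sup>2 = - 1" using q_nz by (simp add: field_simps power2_eq_square eq_neg_iff_add_eq_0)
  then have "q ^ 4 = 1" by (simp add: power2_eq_square eval_nat_numeral)
  then show False using q_nru[of 4] by simp
qed

lemma bf_sq_nz: "u \<noteq> 0 \<Longrightarrow> u ^ 4 \<noteq> 1 \<Longrightarrow> bf (u\<^sup>2) \<noteq> 0"
  by (auto simp: bf_def field_simps simp flip: power_add)

lemma qarg_generic:
  assumes "u \<noteq> 0" "u ^ 4 \<noteq> 1" "u ^ 4 \<noteq> inverse (q\<^sup>2)" "u ^ 4 \<noteq> inverse (q ^ 4)"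
  shows "qarg u \<noteq> 0" "(qarg u)\<^sup>2 \<noteq> 1" "q\<^sup>2 * (qarg u)\<^sup>2 \<noteq> 1" "(qarg u)\<^sup>2 \<noteq> q\<^sup>2"
proof -
  have sq: "(qarg u)\<^sup>2 = q\<^sup>2 * u ^ 4" by (simp add: qarg_def power_mult_distrib flip: power_mult)
  show "qarg u \<noteq> 0" using assms q_nz by (simp add: qarg_def)
  show "(qarg u)\<^sup>2 \<noteq> 1" unfolding sq using assms q_nz by (auto simp: field_simps)
  show "q\<^sup>2 * (qarg u)\<^sup>2 \<noteq> 1" unfolding sq using assms q_nz by (auto simp: field_simps eval_nat_numeral)
  show "(qarg u)\<^sup>2 \<noteq> q\<^sup>2" unfolding sq using assms q_nz by simp
qed

lemma qn_powers:
  shows "q powi (- int n - 1) = 1 / (q * q ^ n)" "q powi (- int n) = 1 / q ^ n"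
    "q powi (int n - 1) = q ^ n / q"
  using q_nz by (simp_all add: power_int_minus power_int_diff divide_inverse mult.commute)

lemma zeta_sq: "pA * q ^ n * zeta\<^sup>2 = 1"
  using zeta by (simp add: pA_def field_simps)

lemma pD_eq: "pD = 1 / (pA * (q ^ n)\<^sup>2)"
  by (simp add: pD_def divide_inverse power_mult[symmetric] mult.commute)

text \<open>Only \<open>z = zeta\<^sup>2\<close> enters: \<open>pA = 1 / (Q * z)\<close> and
  \<open>pD = z / Q\<close>, so each pair of factors with \<open>zeta\<close> becomes the pair with
  parameters \<open>pA\<close> and \<open>pD\<close>.\<close>

lemma zeta_factors:
  assumes "u \<noteq> 0"
  shows "(q ^ (n + 1) * u / zeta - zeta / u) * (q ^ (n + 1) * u * zeta - inverse (u * zeta))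
      = q\<^sup>2 * (q ^ n)\<^sup>2 * u\<^sup>2 * ((1 - pA * inverse (qarg u)) * (1 - pD * inverse (qarg u)))"
    and "(q powi (int n - 1) * zeta / u - u / zeta) * (q powi (int n - 1) / (u * zeta) - u * zeta)
      = (q ^ n)\<^sup>2 / (q\<^sup>2 * u\<^sup>2) * ((1 - pA * qarg u) * (1 - pD * qarg u))"
proof -
  define Q where "Q = q ^ n"
  have Q: "Q \<noteq> 0" using q_nz by (simp add: Q_def)
  define z where "z = zeta\<^sup>2"
  have z: "z \<noteq> 0" using zeta by (simp add: z_def)
  have A: "pA = 1 / (Q * z)" using zeta_sq Q z by (simp add: Q_def z_def field_simps)
  have D: "pD = z / Q" using Q z unfolding pD_eq A by (simp add: Q_def[symmetric] field_simps power2_eq_square)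
  have "(q ^ (n + 1) * u / zeta - zeta / u) * (q ^ (n + 1) * u * zeta - inverse (u * zeta))
      = (q * Q * u)\<^sup>2 - q * Q / z - q * Q * z + 1 / u\<^sup>2"
    using assms zeta(1) by (simp add: Q_def[symmetric] z_def field_simps power2_eq_square)
  also have "\<dots> = q\<^sup>2 * Q\<^sup>2 * u\<^sup>2 * ((1 - pA * inverse (qarg u)) * (1 - pD * inverse (qarg u)))"
    unfolding A D qarg_def using assms z Q q_nz by (simp add: field_simps power2_eq_square)
  finally show "(q ^ (n + 1) * u / zeta - zeta / u) * (q ^ (n + 1) * u * zeta - inverse (u * zeta))
      = q\<^sup>2 * (q ^ n)\<^sup>2 * u\<^sup>2 * ((1 - pA * inverse (qarg u)) * (1 - pD * inverse (qarg u)))"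
    by (simp only: Q_def)
  have "(q powi (int n - 1) * zeta / u - u / zeta) * (q powi (int n - 1) / (u * zeta) - u * zeta)
      = (Q / (q * u))\<^sup>2 - Q / q * z - Q / q / z + u\<^sup>2"
    unfolding qn_powers using assms zeta(1) q_nz by (simp add: Q_def[symmetric] z_def field_simps power2_eq_square)
  also have "\<dots> = Q\<^sup>2 / (q\<^sup>2 * u\<^sup>2) * ((1 - pA * qarg u) * (1 - pD * qarg u))"
    unfolding A D qarg_def using assms z Q q_nz by (simp add: field_simps power2_eq_square)
  finally show "(q powi (int n - 1) * zeta / u - u / zeta) * (q powi (int n - 1) / (u * zeta) - u * zeta)
      = (q ^ n)\<^sup>2 / (q\<^sup>2 * u\<^sup>2) * ((1 - pA * qarg u) * (1 - pD * qarg u))"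
    by (simp only: Q_def)
qed

lemma C_factors:
  assumes "u \<noteq> 0"
  shows "u * cs * q powi (- int n) + b * q ^ n / u = u * cs / q ^ n * (1 - pC * inverse (qarg u))"
    and "q\<^sup>2 * u * b * q ^ n + cs * q powi (- int n) / u = cs / (q ^ n * u) * (1 - pC * qarg u)"
proof -
  define Q where "Q = q ^ n"
  have Q: "Q \<noteq> 0" using q_nz by (simp add: Q_def)
  have C: "pC = - (q * Q\<^sup>2 * b / cs)" by (simp add: pC_def Q_def power_mult[symmetric] mult.commute)
  show "u * cs * q powi (- int n) + b * q ^ n / u = u * cs / q ^ n * (1 - pC * inverse (qarg u))"
    unfolding qn_powers C Q_def[symmetric] qarg_def using assms Q q_nz par_nz
    by (simp add: field_simps power2_eq_square)
  show "q\<^sup>2 * u * b * q ^ n + cs * q powi (- int n) / u = cs / (q ^ n * u) * (1 - pC * qarg u)"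
    unfolding qn_powers C Q_def[symmetric] qarg_def using assms Q q_nz par_nz
    by (simp add: field_simps power2_eq_square)
qed

lemma bs_b: "bs / b = c / cs"
  using par_nz by (simp add: c_eq cs_eq field_simps)

text \<open>The first two identities belong to epsilon = -, the last two to epsilon = +; within each
  pair the first is for \<open>Lam1\<close> and the second for \<open>Lam2\<close>.\<close>

lemma B_factors:
  assumes "u \<noteq> 0"
  shows "u * (c / cs) + 1 / u = u * (c / cs) * (1 - pB * inverse (qarg u))"
    and "q\<^sup>2 * u + (c / cs) / u = c / (cs * u) * (1 - pB * qarg u)"
    and "u + (bs / b) / u = c / (cs * u) * (1 + Bp * qarg u)"
    and "q\<^sup>2 * u * (bs / b) + 1 / u = q\<^sup>2 * u * (c / cs) * (1 + Bp * inverse (qarg u))"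
  unfolding bs_b Bp_def unfolding pB_def qarg_def using assms par_nz q_nz
  by (simp_all add: field_simps power2_eq_square)

lemma bf_products:
  assumes "u \<noteq> 0"
  shows "bf (u\<^sup>2) * bf (q * u\<^sup>2) = q * u ^ 4 * ((1 - (inverse (qarg u))\<^sup>2) * (1 - q\<^sup>2 * (inverse (qarg u))\<^sup>2))"
    and "bf (q * u\<^sup>2) * bf (q\<^sup>2 * u\<^sup>2) = (1 - (qarg u)\<^sup>2) * (1 - q\<^sup>2 * (qarg u)\<^sup>2) / (q ^ 3 * u ^ 4)"
    and "bf (u\<^sup>2) * bf (q\<^sup>2 * u\<^sup>2) = (joukowski (qarg u))\<^sup>2 - (q\<^sup>2 + 2 + 1 / q\<^sup>2)"
proof -
  define w where "w = u\<^sup>2"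
  have w: "w \<noteq> 0" using assms by (simp add: w_def)
  have w4: "u ^ 4 = w\<^sup>2" by (simp add: w_def flip: power_mult)
  show "bf (u\<^sup>2) * bf (q * u\<^sup>2) = q * u ^ 4 * ((1 - (inverse (qarg u))\<^sup>2) * (1 - q\<^sup>2 * (inverse (qarg u))\<^sup>2))"
    unfolding bf_def qarg_def w4 w_def[symmetric] using w q_nz
    by (simp add: field_simps power2_eq_square)
  show "bf (q * u\<^sup>2) * bf (q\<^sup>2 * u\<^sup>2) = (1 - (qarg u)\<^sup>2) * (1 - q\<^sup>2 * (qarg u)\<^sup>2) / (q ^ 3 * u ^ 4)"
    unfolding bf_def qarg_def w4 w_def[symmetric] using w q_nz
    by (simp add: field_simps power2_eq_square power3_eq_cube)
  show "bf (u\<^sup>2) * bf (q\<^sup>2 * u\<^sup>2) = (joukowski (qarg u))\<^sup>2 - (q\<^sup>2 + 2 + 1 / q\<^sup>2)"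
    unfolding bf_def qarg_def joukowski_def w_def[symmetric] using w q_nz
    by (simp add: field_simps power2_eq_square)
qed

text \<open>In \<open>Yfun\<close> this term multiplies the values at \<open>v / q\<^sup>2\<close>,
  so it has to be the shift coefficient at \<open>inverse v\<close>.\<close>

lemma down_coeff:
  assumes "u \<noteq> 0"
  shows "u powi (2 * (- 1) + 1) * Lam1 q n b c bs cs zeta (- 1) u / (bf (u\<^sup>2) * bf (q * u\<^sup>2))
      = hom.shift_coeff (inverse (qarg u))" (is ?hom)
    and "u powi (2 * 1 + 1) * Lam1 q n b c bs cs zeta 1 u / (bf (u\<^sup>2) * bf (q * u\<^sup>2))
      = inhom.shift_coeff (inverse (qarg u))" (is ?inhom)
proof -
  define Q where "Q = q ^ n"
  have Q: "Q \<noteq> 0" using q_nz by (simp add: Q_def)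
  define K where "K = (1 - pA * inverse (qarg u)) * (1 - pD * inverse (qarg u))"
  define L where "L = 1 - pC * inverse (qarg u)"
  define N where "N = (1 - (inverse (qarg u))\<^sup>2) * (1 - q\<^sup>2 * (inverse (qarg u))\<^sup>2)"
  have "Lam1 q n b c bs cs zeta (- 1) u = 1 / (q * Q) * u * (q\<^sup>2 * Q\<^sup>2 * u\<^sup>2 * K) * (u * cs / Q * L)
      * (u * (c / cs) * (1 - pB * inverse (qarg u)))"
    unfolding Lam1_def K_def L_def Q_def zeta_factors(1)[OF assms, symmetric] C_factors(1)[OF assms, symmetric]
      B_factors(1)[OF assms, symmetric] qn_powers(1)[symmetric]
    using assms by (simp add: power_int_minus divide_inverse mult_ac)
  also have "\<dots> = u * (q * u ^ 4) * (c * (K * L * (1 - pB * inverse (qarg u))))"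
    using assms Q q_nz par_nz by (simp add: divide_simps) (simp add: eval_nat_numeral mult_ac)
  finally have 1: "Lam1 q n b c bs cs zeta (- 1) u = \<dots>" .
  show ?hom
    unfolding 1 bf_products[OF assms] N_def[symmetric] hom.shift_coeff_def
    using assms q_nz by (simp add: K_def L_def power_int_minus mult_ac)
  have "Lam1 q n b c bs cs zeta 1 u = 1 / (q * Q) / u * (q\<^sup>2 * Q\<^sup>2 * u\<^sup>2 * K) * (u * cs / Q * L)
      * (c / (cs * u) * (1 + Bp * qarg u))"
    unfolding Lam1_def K_def L_def Q_def zeta_factors(1)[OF assms, symmetric] C_factors(1)[OF assms, symmetric]
      B_factors(3)[OF assms, symmetric] qn_powers(1)[symmetric]
    using assms by (simp add: mult_ac)
  also have "\<dots> = q * u * (c * (K * L * (1 + Bp * qarg u)))"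
    using assms Q q_nz par_nz by (simp add: divide_simps) (simp add: eval_nat_numeral mult_ac)
  finally have 2: "Lam1 q n b c bs cs zeta 1 u = \<dots>" .
  have u3: "u powi (2 * 1 + 1) = u ^ 3" by (simp add: power_int_def)
  have gen: "u ^ 3 * (q * u * X) / (q * u ^ 4 * Y) = X / Y" for X Y
    using assms q_nz by (simp add: divide_simps) (simp add: eval_nat_numeral)
  show ?inhom
    unfolding 2 u3 bf_products[OF assms] N_def[symmetric] inhom.shift_coeff_def gen
    by (simp add: K_def L_def divide_inverse mult_ac)
qed

text \<open>This term multiplies the values at \<open>q\<^sup>2 * v\<close>. \<open>Lam2\<close>
  carries a factor \<open>bf (u\<^sup>2)\<close> that cancels against the denominator, whence the
  hypothesis on \<open>u ^ 4\<close>.\<close>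

lemma up_coeff:
  assumes u: "u \<noteq> 0" and g: "u ^ 4 \<noteq> 1"
  shows "q powi (- (- 1) - 1) / u * Lam2 q n b c bs cs zeta (- 1) u / (bf (u\<^sup>2) * bf (q\<^sup>2 * u\<^sup>2))
      = hom.shift_coeff (qarg u)" (is ?hom)
    and "q powi (- 1 - 1) / u * Lam2 q n b c bs cs zeta 1 u / (bf (u\<^sup>2) * bf (q\<^sup>2 * u\<^sup>2))
      = inhom.shift_coeff (qarg u)" (is ?inhom)
proof -
  define Q where "Q = q ^ n"
  have Q: "Q \<noteq> 0" using q_nz by (simp add: Q_def)
  define K where "K = (1 - pA * qarg u) * (1 - pD * qarg u)"
  define L where "L = 1 - pC * qarg u"
  have bu: "bf (u\<^sup>2) \<noteq> 0"
    by (rule bf_sq_nz[OF u g])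
  define N where "N = (1 - (qarg u)\<^sup>2) * (1 - q\<^sup>2 * (qarg u)\<^sup>2)"
  have "Lam2 q n b c bs cs zeta (- 1) u = bf (u\<^sup>2) / bf (q * u\<^sup>2) * (1 / (q * Q)) * u * (Q\<^sup>2 / (q\<^sup>2 * u\<^sup>2) * K)
      * (cs / (Q * u) * L) * (c / (cs * u) * (1 - pB * qarg u))"
    unfolding Lam2_def K_def L_def Q_def zeta_factors(2)[OF u, symmetric] C_factors(2)[OF u, symmetric]
      B_factors(2)[OF u, symmetric] qn_powers(1)[symmetric]
    using u by (simp add: power_int_minus bf_def divide_inverse mult_ac)
  also have "\<dots> = bf (u\<^sup>2) / bf (q * u\<^sup>2) * (u / (q ^ 3 * u ^ 4)) * (c * (K * L * (1 - pB * qarg u)))"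
    using u Q q_nz par_nz by (simp add: divide_simps) (simp add: eval_nat_numeral mult_ac)
  finally have 1: "Lam2 q n b c bs cs zeta (- 1) u = \<dots>" .
  have "q powi (- (- 1) - 1) / u * Lam2 q n b c bs cs zeta (- 1) u / (bf (u\<^sup>2) * bf (q\<^sup>2 * u\<^sup>2))
      = c * (K * L * (1 - pB * qarg u)) / (q ^ 3 * u ^ 4) / (bf (q * u\<^sup>2) * bf (q\<^sup>2 * u\<^sup>2))"
    unfolding 1 using bu u by (simp add: divide_inverse mult_ac)
  then show ?hom
    unfolding bf_products(2)[OF u] N_def[symmetric] hom.shift_coeff_def
    using u q_nz by (simp add: K_def L_def mult_ac)
  have "Lam2 q n b c bs cs zeta 1 u = bf (u\<^sup>2) / bf (q * u\<^sup>2) * (1 / (q * Q)) / u * (Q\<^sup>2 / (q\<^sup>2 * u\<^sup>2) * K)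
      * (cs / (Q * u) * L) * (q\<^sup>2 * u * (c / cs) * (1 + Bp * inverse (qarg u)))"
    unfolding Lam2_def K_def L_def Q_def zeta_factors(2)[OF u, symmetric] C_factors(2)[OF u, symmetric]
      B_factors(4)[OF u, symmetric] qn_powers(1)[symmetric]
    using u by (simp add: bf_def divide_inverse mult_ac)
  also have "\<dots> = bf (u\<^sup>2) / bf (q * u\<^sup>2) * (q\<^sup>2 * u / (q ^ 3 * u ^ 4)) * (c * (K * L * (1 + Bp * inverse (qarg u))))"
    using u Q q_nz par_nz by (simp add: divide_simps) (simp add: eval_nat_numeral mult_ac)
  finally have 2: "Lam2 q n b c bs cs zeta 1 u = \<dots>" .
  have q2: "q powi (- 1 - 1) = 1 / q\<^sup>2" by (simp add: power_int_def divide_inverse power_inverse)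
  have "q powi (- 1 - 1) / u * Lam2 q n b c bs cs zeta 1 u / (bf (u\<^sup>2) * bf (q\<^sup>2 * u\<^sup>2))
      = c * (K * L * (1 + Bp * inverse (qarg u))) / (q ^ 3 * u ^ 4) / (bf (q * u\<^sup>2) * bf (q\<^sup>2 * u\<^sup>2))"
  proof -
    have gen: "1 / q\<^sup>2 / u * (z / y * (q\<^sup>2 * u / w) * X) / (z * t) = X / w / (y * t)" if "z \<noteq> 0" for z y w X t
      using that u q_nz by (simp add: divide_simps)
    show ?thesis unfolding 2 q2 by (rule gen[OF bu])
  qed
  then show ?inhom
    unfolding bf_products(2)[OF u] N_def[symmetric] inhom.shift_coeff_def
    using u q_nz by (simp add: K_def L_def divide_inverse mult_ac)
qed

text \<open>Pairing the first factor at \<open>j\<close> with the second at \<open>n - j\<close>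
  makes the product of the two half-integer powers equal to \<open>q\<close>. Each pair is then
  \<open>joukowski (qarg u)\<close> minus a node, and all nodes from 0 to \<open>n\<close> occur
  once.\<close>

lemma inhom_term:
  assumes u: "u \<noteq> 0"
  shows "q powi (- 1 - 2 * int n) * cs * (\<Prod>j\<in>{0..n}. bf (csqrt q powi (1 + 2 * int j - int n) * u * zeta)
      * bf (csqrt q powi (1 + 2 * int j - int n) * u / zeta))
    = c * Bp / (q\<^sup>2) ^ n * poly (newton_poly pA (q\<^sup>2) (Suc n)) (joukowski (qarg u))"
proof -
  define h where "h = csqrt q"
  have h2: "h\<^sup>2 = q" by (simp add: h_def)
  have h: "h \<noteq> 0" using q_nz h2 by auto
  define x where "x j = h powi (1 + 2 * int j - int n)" for j
  have x: "x j \<noteq> 0" for j using h by (simp add: x_def)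
  have xx: "x j * x (n - j) = q" if "j \<le> n" for j
  proof -
    have "x j * x (n - j) = h powi (1 + 2 * int j - int n + (1 + 2 * int (n - j) - int n))"
      unfolding x_def by (subst power_int_add) (use h in auto)
    also have "1 + 2 * int j - int n + (1 + 2 * int (n - j) - int n) = 2" using that by simp
    finally show ?thesis using h2 by simp
  qed
  have fac: "bf (x j * u * zeta) * bf (x (n - j) * u / zeta) = joukowski (qarg u) - qnode pA (q\<^sup>2) (n - j)"
    if j: "j \<le> n" for j
  proof -
    have "bf (s * u * zeta) * bf (t * u / zeta) = (s * t) * u\<^sup>2 + inverse ((s * t) * u\<^sup>2) - (s * inverse t * zeta\<^sup>2 + inverse (s * inverse t * zeta\<^sup>2))"
      if "s \<noteq> 0" "t \<noteq> 0" for s t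
      using that u zeta(1) by (simp add: bf_def field_simps power2_eq_square)
    from this[OF x[of j] x[of "n - j"]] have "bf (x j * u * zeta) * bf (x (n - j) * u / zeta) =
        joukowski (qarg u) - joukowski (x j * inverse (x (n - j)) * zeta\<^sup>2)"
      unfolding xx[OF j] by (simp add: joukowski_def qarg_def)
    also have "x j * inverse (x (n - j)) * zeta\<^sup>2 = inverse (pA * (q\<^sup>2) ^ (n - j))"
    proof -
      have "x (n - j) = q / x j" using xx[OF j] x[of j] by (simp add: field_simps)
      then have "x j * inverse (x (n - j)) = (x j)\<^sup>2 / q" using x q_nz by (simp add: field_simps power2_eq_square)
      moreover have "(x j)\<^sup>2 = q powi (1 + 2 * int j - int n)"
        unfolding x_def h2[symmetric] by (simp add: power_int_mult[symmetric] mult.commute flip: power_int_of_nat power_int_numeral)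
      moreover have "q powi (1 + 2 * int j - int n) = q * q ^ n / (q\<^sup>2) ^ (n - j)"
      proof -
        have "q powi (1 + int n - 2 * int k) = q * q ^ n / (q\<^sup>2) ^ k" for k
          using q_nz by (simp add: power_int_diff power_int_add power_int_mult)
        moreover have "1 + 2 * int j - int n = 1 + int n - 2 * int (n - j)" using j by simp
        ultimately show ?thesis by (simp only:)
      qed
      ultimately have "x j * inverse (x (n - j)) * zeta\<^sup>2 = (pA * q ^ n * zeta\<^sup>2) / (pA * (q\<^sup>2) ^ (n - j))"
        using q_nz pABC_nz by simp
      then show ?thesis unfolding zeta_sq by (simp add: divide_inverse)
    qed
    finally show ?thesis by (simp only: joukowski_inverse qnode_def)
  qed
  have "(\<Prod>j\<in>{0..n}. bf (x j * u * zeta) * bf (x j * u / zeta))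
      = (\<Prod>j\<in>{0..n}. bf (x j * u * zeta)) * (\<Prod>j\<in>{0..n}. bf (x (n - j) * u / zeta))"
    unfolding prod.distrib
    by (subst (2) prod.atLeastAtMost_rev) simp
  also have "\<dots> = (\<Prod>j\<in>{0..n}. joukowski (qarg u) - qnode pA (q\<^sup>2) (n - j))"
    unfolding prod.distrib[symmetric] by (intro prod.cong refl) (simp add: fac)
  also have "\<dots> = (\<Prod>j\<in>{0..n}. joukowski (qarg u) - qnode pA (q\<^sup>2) j)"
    by (subst (2) prod.atLeastAtMost_rev) simp
  also have "\<dots> = poly (newton_poly pA (q\<^sup>2) (Suc n)) (joukowski (qarg u))"
    unfolding poly_newton_poly by (simp add: lessThan_Suc_atMost atLeast0AtMost)
  finally have P: "(\<Prod>j\<in>{0..n}. bf (x j * u * zeta) * bf (x j * u / zeta)) = \<dots>" .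
  have "q powi (- 1 - 2 * int n) * cs = c * Bp / (q\<^sup>2) ^ n"
  proof -
    have "q powi (- 1 - 2 * int n) = 1 / (q * (q\<^sup>2) ^ n)"
      using q_nz by (simp add: power_int_diff power_int_minus power_int_mult divide_inverse)
    then show ?thesis unfolding Bp_def unfolding pB_def using q_nz par_nz by (simp add: power2_eq_square)
  qed
  with P show ?thesis by (simp only: x_def h_def)
qed

text \<open>After multiplication by \<open>W\<close> both sides are linear in \<open>J\<close>. The
  two coefficients are compared through \<open>diag_coeff_eq\<close>; \<open>o1\<close> and
  \<open>o2\<close> are the omegas stripped of their common prefactor.\<close>

lemma diag_eq:
  assumes u: "u \<noteq> 0" and g: "u ^ 4 \<noteq> 1" "u ^ 4 \<noteq> inverse (q\<^sup>2)" "u ^ 4 \<noteq> inverse (q ^ 4)"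
  shows "(q + inverse q)\<^sup>2 / (rho q r0 * bf (u\<^sup>2) * bf (q\<^sup>2 * u\<^sup>2))
        * (etas q n r0 b c bs cs bd cd + eta q n r0 b c bs cs bd cd
             * ((q * u\<^sup>2 + inverse (q * u\<^sup>2)) / (q + inverse q))) = diag_coeff (qarg u)"
proof -
  define Q where "Q = q ^ n"
  have Q: "Q \<noteq> 0" using q_nz by (simp add: Q_def)
  note v = qarg_generic[OF u g]
  define W where "W = bf (u\<^sup>2) * bf (q\<^sup>2 * u\<^sup>2)"
  define J where "J = joukowski (qarg u)"
  have W: "W = J\<^sup>2 - (q\<^sup>2 + 2 + 1 / q\<^sup>2)"
    unfolding W_def J_def by (rule bf_products(3)[OF u])
  have W0: "W \<noteq> 0"
  proof -
    have "bf (u\<^sup>2) \<noteq> 0" by (rule bf_sq_nz[OF u g(1)])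
    moreover have "bf (q\<^sup>2 * u\<^sup>2) \<noteq> 0"
      using u q_nz g(3) by (auto simp: bf_def field_simps eval_nat_numeral)
    ultimately show ?thesis by (simp add: W_def)
  qed
  have qm: "q - inverse q \<noteq> 0"
  proof
    assume "q - inverse q = 0"
    then have "q ^ 2 = 1" using q_nz by (simp add: field_simps power2_eq_square)
    then show False using q_nru[of 2] by simp
  qed
  have thn: "th q x y (int n) = x * Q + y / Q" for x y
    by (simp add: th_def Q_def power_int_minus divide_inverse)
  have qq: "q powi (int n + 1) + q powi (- int n - 1) = q * Q + 1 / (q * Q)"
    unfolding qn_powers using q_nz by (simp add: power_int_add Q_def mult.commute)
  have Q2: "q ^ (2 * n) = Q\<^sup>2" by (simp add: Q_def mult.commute flip: power_mult)
  have pars: "pA = r0 * bd" "pB = - (q * b / bs)" "pC = - (q * Q\<^sup>2 * b * bs * r0\<^sup>2)" "pD = 1 / (r0 * bd * Q\<^sup>2)"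
    unfolding pD_eq Q_def[symmetric] unfolding pA_def pB_def pC_def
    using par_nz q_nz by (simp_all add: c_eq cs_eq Q2 Q2[unfolded mult.commute[of 2]] field_simps)
  have rho: "rho q r0 = - ((q - inverse q)\<^sup>2 * (q + inverse q)\<^sup>2 / r0\<^sup>2)"
  proof -
    have "q powi (- 2) = (inverse q)\<^sup>2" by (simp add: power_int_def power_inverse)
    then have "q\<^sup>2 - q powi (- 2) = (q - inverse q) * (q + inverse q)" by (simp add: algebra_simps power2_eq_square)
    then show ?thesis by (simp add: rho_def power_mult_distrib)
  qed
  define o1 where "o1 = (b * Q + c / Q) * (bd * Q + cd / Q) - inverse r0 * (q * Q + 1 / (q * Q)) * (bs * Q + cs / Q)"
  define o2 where "o2 = (bs * Q + cs / Q) * (bd * Q + cd / Q) - inverse r0 * (q * Q + 1 / (q * Q)) * (b * Q + c / Q)"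
  have e1: "eta q n r0 b c bs cs bd cd = (q + inverse q) / r0 * (- ((q - inverse q)\<^sup>2) * o1)"
    by (simp only: eta_def omega_def fst_conv snd_conv thn qq o1_def)
  have e2: "etas q n r0 b c bs cs bd cd = (q + inverse q) / r0 * (- ((q - inverse q)\<^sup>2) * o2)"
    by (simp only: etas_def omega_def fst_conv snd_conv thn qq o2_def)
  have "(q + inverse q)\<^sup>2 / (rho q r0 * W) * (etas q n r0 b c bs cs bd cd + eta q n r0 b c bs cs bd cd
             * (J / (q + inverse q))) = r0 * (o1 * J + (q + inverse q) * o2) / W"
    unfolding rho e1 e2 using W0 q_plus_nz qm par_nz by (simp add: divide_simps) (simp add: algebra_simps power2_eq_square)
  moreover have "r0 * o1 = c / q\<^sup>2 * (q\<^sup>2 * (pA + pB + pC + pD) + (pA * pB * pC + pA * pB * pD + pA * pC * pD + pB * pC * pD))"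
    unfolding o1_def pars unfolding c_eq cs_eq cd_eq using par_nz q_nz Q
    by (simp add: field_simps) (simp add: eval_nat_numeral algebra_simps)
  moreover have "r0 * ((q + inverse q) * o2) = - (c / q\<^sup>2 * ((q\<^sup>2 + 1) *
      (pA * pB + pA * pC + pA * pD + pB * pC + pB * pD + pC * pD + q\<^sup>2 + pA * pB * pC * pD / q\<^sup>2)))"
    unfolding o2_def pars unfolding c_eq cs_eq cd_eq using par_nz q_nz Q
    by (simp add: field_simps) (simp add: eval_nat_numeral algebra_simps)
  ultimately have "(q + inverse q)\<^sup>2 / (rho q r0 * W) * (etas q n r0 b c bs cs bd cd + eta q n r0 b c bs cs bd cd
             * (J / (q + inverse q))) = diag_coeff (qarg u) * W / W"
    unfolding W J_def diag_coeff_eq[OF v] by (simp only: distrib_left right_diff_distrib mult.assoc[symmetric]) simp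
  then show ?thesis
    using W0 by (simp add: W_def J_def joukowski_def qarg_def mult.assoc)
qed

end

section \<open>The sum over \<open>k\<close>\<close>

lemma prod_list_Ybar: "prod_list (map f (Ybar n y k)) = (\<Prod>i\<in>{1..n+1} - {k}. f (y i))"
proof -
  have "prod_list (map f (Ybar n y k)) = prod_list (map (\<lambda>i. f (y i)) (filter (\<lambda>i. i \<noteq> k) [1..<n + 2]))"
    by (simp add: Ybar_def o_def)
  also have "\<dots> = (\<Prod>i\<in>set (filter (\<lambda>i. i \<noteq> k) [1..<n + 2]). f (y i))"
    by (rule prod.distinct_set_conv_list[symmetric]) simp
  also have "set (filter (\<lambda>i. i \<noteq> k) [1..<n + 2]) = {1..n+1} - {k}" by auto
  finally show ?thesis .
qed

context aw_parameters
begin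

lemma bf_pairs:
  assumes "u \<noteq> 0" "w \<noteq> 0"
  shows "bf (u / w) * bf (q * u * w) = joukowski (qarg u) - joukowski (qarg w)"
    and "bf (u / (q * w)) * bf (u * w) = joukowski (qarg u / q\<^sup>2) - joukowski (qarg w)"
    and "bf (q * u / w) * bf (q\<^sup>2 * u * w) = joukowski (q\<^sup>2 * qarg u) - joukowski (qarg w)"
  unfolding bf_def joukowski_def qarg_def using assms q_nz
  by (simp_all add: field_simps power2_eq_square)

text \<open>The argument shared by both signs: \<open>hY\<close> absorbs the diagonal part of
  \<open>Lmat\<close> into \<open>h\<close>, \<open>hw\<close> is the left eigenvector property, and
  \<open>K\<close> stands for every factor independent of \<open>k\<close>.\<close>

lemma bethe_sum_eq_0:
  fixes y :: "nat \<Rightarrow> complex" and w :: "nat \<Rightarrow> complex" and h :: "complex poly"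
  defines "S \<equiv> {1..n+1}" and "V \<equiv> \<lambda>i. joukowski (qarg (y i))"
  assumes y_nz: "\<And>i. i \<in> S \<Longrightarrow> y i \<noteq> 0"
    and y_gen: "\<And>i. i \<in> S \<Longrightarrow> y i ^ 4 \<noteq> 1 \<and> y i ^ 4 \<noteq> inverse (q\<^sup>2) \<and> y i ^ 4 \<noteq> inverse (q ^ 4)"
    and inj: "inj_on V S" and j: "j \<in> S"
    and h: "degree h \<le> n"
    and hY: "\<And>k. k \<in> S \<Longrightarrow> poly h (V k) = Yfun q n b c bs cs zeta e (y k) (Ybar n y j)
        + diag_coeff (qarg (y k)) * (\<Prod>i\<in>S - {j}. V k - V i)"
    and hw: "(\<Sum>N\<le>n. w N * poly h (qnode pA (q\<^sup>2) N))
        = \<theta> * (\<Sum>N\<le>n. w N * (\<Prod>i\<in>S - {j}. qnode pA (q\<^sup>2) N - V i))"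
    and X: "\<And>k. k \<in> S \<Longrightarrow> X (Ybar n y k) = K * (\<Prod>i\<in>S - {k}. bf ((y i)\<^sup>2) * y i powi (- e))
        * (\<Sum>N\<le>n. w N * (\<Prod>i\<in>S - {k}. V i - qnode pA (q\<^sup>2) N))"
  shows "(\<Sum>k\<in>S. (Lmat q n r0 b c bs cs bd cd zeta y e j k - (if j = k then \<theta> else 0)) * X (Ybar n y k)) = 0"
proof -
  have S: "finite S" "card S = Suc n" by (simp_all add: S_def)
  define G where "G k = inverse (\<Prod>i\<in>S - {k}. V k - V i)" for k
  define t where "t i = bf ((y i)\<^sup>2) * y i powi (- e)" for i
  define T where "T = (\<Prod>i\<in>S. t i)"
  have bf0: "bf ((y i)\<^sup>2) \<noteq> 0" if "i \<in> S" for i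
    using bf_sq_nz y_nz[OF that] y_gen[OF that] by blast
  have t0: "t i \<noteq> 0" if "i \<in> S" for i
    using bf0[OF that] y_nz[OF that] by (simp add: t_def)
  \<comment> \<open>The gauge factor of \<open>X\<close> at the tuple without \<open>y k\<close> is
    completed to the full product \<open>T\<close> by the \<open>t k\<close> in \<open>Lmat\<close>,
    so it leaves the sum over \<open>k\<close>.\<close>
  have T: "T = t k * (\<Prod>i\<in>S - {k}. t i)" if "k \<in> S" for k
    unfolding T_def using S that by (simp add: prod.remove)
  have g: "gfun q (y k) (Ybar n y k) = G k" if k: "k \<in> S" for k
  proof -
    have "gfun q (y k) (Ybar n y k) = (\<Prod>i\<in>S - {k}. inverse (V k - V i))"
      unfolding gfun_def prod_list_Ybar S_def[symmetric] V_def
      using y_nz k by (intro prod.cong refl) (simp add: bf_pairs)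
    then show ?thesis by (simp add: G_def prod_inversef[symmetric] o_def)
  qed
  have Lm: "Lmat q n r0 b c bs cs bd cd zeta y e j k = t k / t j * G k * poly h (V k)" if k: "k \<in> S" for k
  proof -
    have pre: "(y j / y k) powi e * bf ((y k)\<^sup>2) / bf ((y j)\<^sup>2) = t k / t j"
      unfolding t_def power_int_divide_distrib power_int_minus by (simp add: divide_inverse mult_ac)
    show ?thesis
    proof (cases "k = j")
      case False
      \<comment> \<open>Off the diagonal \<open>V k\<close> is one of the roots, so the
        \<open>diag_coeff\<close> part of \<open>hY\<close> drops out; for \<open>k = j\<close> that
        part is cleared by \<open>G j\<close> and becomes the delta term.\<close>
      then have "(\<Prod>i\<in>S - {j}. V k - V i) = 0" using S k by (intro prod_zero) auto
      with False show ?thesis unfolding Lmat_def g[OF k] pre hY[OF k] by simp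
    next
      case True
      have "(\<Prod>i\<in>S - {j}. V j - V i) \<noteq> 0"
        using S inj j by (auto simp: inj_on_def)
      then have "G j * (\<Prod>i\<in>S - {j}. V j - V i) = 1" by (simp add: G_def)
      then have "G j * poly h (V j) = G j * Yfun q n b c bs cs zeta e (y j) (Ybar n y j) + diag_coeff (qarg (y j))"
        unfolding hY[OF j] by (simp add: algebra_simps)
      then show ?thesis
        unfolding Lmat_def True g[OF j] pre[unfolded True]
        using diag_eq[of "y j"] y_nz[OF j] y_gen[OF j] t0[OF j] by simp
    qed
  qed
  have "(\<Sum>k\<in>S. (Lmat q n r0 b c bs cs bd cd zeta y e j k - (if j = k then \<theta> else 0)) * X (Ybar n y k))
      = (\<Sum>k\<in>S. Lmat q n r0 b c bs cs bd cd zeta y e j k * X (Ybar n y k)) - \<theta> * X (Ybar n y j)"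
    using S j by (simp add: left_diff_distrib sum_subtractf if_distrib[of "\<lambda>z. z * _"] cong: if_cong)
  also have "(\<Sum>k\<in>S. Lmat q n r0 b c bs cs bd cd zeta y e j k * X (Ybar n y k))
      = (\<Sum>k\<in>S. K * T / t j * (\<Sum>N\<le>n. w N * (G k * poly h (V k) * (\<Prod>i\<in>S - {k}. V i - qnode pA (q\<^sup>2) N))))"
  proof (intro sum.cong refl)
    fix k assume k: "k \<in> S"
    have "Lmat q n r0 b c bs cs bd cd zeta y e j k * X (Ybar n y k) = K * T / t j * (G k * poly h (V k)
        * (\<Sum>N\<le>n. w N * (\<Prod>i\<in>S - {k}. V i - qnode pA (q\<^sup>2) N)))"
      unfolding Lm[OF k] X[OF k] t_def[symmetric] T[OF k] by simp
    then show "Lmat q n r0 b c bs cs bd cd zeta y e j k * X (Ybar n y k)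
        = K * T / t j * (\<Sum>N\<le>n. w N * (G k * poly h (V k) * (\<Prod>i\<in>S - {k}. V i - qnode pA (q\<^sup>2) N)))"
      by (simp add: sum_distrib_left mult_ac)
  qed
  also have "\<dots> = K * T / t j * (\<Sum>N\<le>n. w N * (\<Sum>k\<in>S. G k * poly h (V k) * (\<Prod>i\<in>S - {k}. V i - qnode pA (q\<^sup>2) N)))"
    unfolding sum_distrib_left[symmetric] by (subst sum.swap) (simp only: sum_distrib_left)
  also have "\<dots> = K * T / t j * (\<Sum>N\<le>n. w N * ((- 1) ^ n * poly h (qnode pA (q\<^sup>2) N)))"
  proof -
    have flip: "(\<Prod>i\<in>S - {k}. V i - x) = (- 1) ^ n * (\<Prod>i\<in>S - {k}. x - V i)" if "k \<in> S" for k x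
      using S that prod_uminus[of "\<lambda>i. x - V i" "S - {k}"] by simp
    have "(\<Sum>k\<in>S. G k * poly h (V k) * (\<Prod>i\<in>S - {k}. V i - x)) = (- 1) ^ n * poly h x" for x
    proof -
      have "(\<Sum>k\<in>S. G k * poly h (V k) * (\<Prod>i\<in>S - {k}. V i - x))
          = (- 1) ^ n * (\<Sum>k\<in>S. poly h (V k) / (\<Prod>i\<in>S - {k}. V k - V i) * (\<Prod>i\<in>S - {k}. x - V i))"
        unfolding sum_distrib_left by (intro sum.cong refl) (simp add: flip G_def divide_inverse)
      also have "\<dots> = (- 1) ^ n * poly h x"
        using lagrange_interpolation[OF S(1) inj, of h x] h S by simp
      finally show ?thesis .
    qed
    then show ?thesis by (simp only:)
  qed
  also have "\<dots> = K * T / t j * (- 1) ^ n * (\<Sum>N\<le>n. w N * poly h (qnode pA (q\<^sup>2) N))"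
    by (simp add: sum_distrib_left mult_ac)
  also have "\<dots> = \<theta> * X (Ybar n y j)"
  proof -
    have "(\<Prod>i\<in>S - {j}. V i - x) = (- 1) ^ n * (\<Prod>i\<in>S - {j}. x - V i)" for x
      using S j prod_uminus[of "\<lambda>i. x - V i" "S - {j}"] by simp
    then have "X (Ybar n y j) = K * T / t j * (- 1) ^ n * (\<Sum>N\<le>n. w N * (\<Prod>i\<in>S - {j}. qnode pA (q\<^sup>2) N - V i))"
      unfolding X[OF j] t_def[symmetric] T[OF j] using t0[OF j] by (simp add: sum_distrib_left mult_ac)
    then show ?thesis unfolding hw by simp
  qed
  finally show ?thesis by simp
qed

lemma Yfun_eq:
  fixes y :: "nat \<Rightarrow> complex" and j :: nat
  assumes u: "u \<noteq> 0" "u ^ 4 \<noteq> 1" and y_nz: "\<And>i. i \<in> {1..n+1} \<Longrightarrow> y i \<noteq> 0"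
  defines "f \<equiv> \<lambda>x. \<Prod>i\<in>{1..n+1} - {j}. x - joukowski (qarg (y i))"
  shows "Yfun q n b c bs cs zeta (- 1) u (Ybar n y j) =
      hom.shift_coeff (inverse (qarg u)) * f (joukowski (qarg u / q\<^sup>2))
      + hom.shift_coeff (qarg u) * f (joukowski (q\<^sup>2 * qarg u))" (is ?hom)
    and "Yfun q n b c bs cs zeta 1 u (Ybar n y j) =
      inhom.shift_coeff (inverse (qarg u)) * f (joukowski (qarg u / q\<^sup>2))
      + inhom.shift_coeff (qarg u) * f (joukowski (q\<^sup>2 * qarg u))
      - c * Bp / (q\<^sup>2) ^ n * poly (newton_poly pA (q\<^sup>2) (Suc n)) (joukowski (qarg u))" (is ?inhom)
proof -
  have p1: "prod_list (map (\<lambda>ui. bf (u / (q * ui)) * bf (u * ui)) (Ybar n y j)) = f (joukowski (qarg u / q\<^sup>2))"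
    unfolding prod_list_Ybar f_def using u y_nz by (intro prod.cong refl) (simp add: bf_pairs)
  have p2: "prod_list (map (\<lambda>ui. bf (q * u / ui) * bf (q\<^sup>2 * u * ui)) (Ybar n y j)) = f (joukowski (q\<^sup>2 * qarg u))"
    unfolding prod_list_Ybar f_def using u y_nz by (intro prod.cong refl) (simp add: bf_pairs)
  show ?hom
    unfolding Yfun_def p1 p2 down_coeff(1)[OF u(1)] up_coeff(1)[OF u] by simp
  show ?inhom
    unfolding Yfun_def p1 p2 down_coeff(2)[OF u(1)] up_coeff(2)[OF u] inhom_term[OF u(1)] by simp
qed

text \<open>The constants are left unsimplified, down to \<open>- (- 1)\<close>, so that both
  equations match the pattern with \<open>K\<close> and \<open>e\<close> in
  \<open>bethe_sum_eq_0\<close>.\<close>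

lemma Xfun_eq:
  fixes y :: "nat \<Rightarrow> complex"
  assumes M: "M \<le> n" and k: "k \<in> {1..n+1}"
  defines "\<Phi> \<equiv> \<lambda>N. \<Prod>i\<in>{1..n+1} - {k}. joukowski (qarg (y i)) - qnode pA (q\<^sup>2) N"
  shows "Xfun q n r0 b c bs cs bd cd (- 1) M (Ybar n y k) =
      ((- 1) * (q + inverse q) * q powi (- (- 1) * (int n + 1)) * b) ^ n * Ffun q r0 b c cs bd M
        / nu q n r0 (bd, cd) (b, c) (bs, cs) * inverse (q + inverse q) ^ n
      * (\<Prod>i\<in>{1..n+1} - {k}. bf ((y i)\<^sup>2) * y i powi (- (- 1)))
      * (\<Sum>N\<le>n. weight N * eigfun M N * \<Phi> N)" (is ?minus)
    and "Xfun q n r0 b c bs cs bd cd 1 M (Ybar n y k) =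
      ((q + inverse q) * q powi (- 1 * (int n + 1)) * cs) ^ n
        * (kappa q n r0 b bs bd * Ffun q r0 b c cs bd M / nu q n r0 (bs, cs) (bd, cd) (b, c))
        / nu q n r0 (bd, cd) (b, c) (bs, cs) * inverse (q + inverse q) ^ n
      * (\<Prod>i\<in>{1..n+1} - {k}. bf ((y i)\<^sup>2) * y i powi (- 1))
      * (\<Sum>N\<le>n. weight N * eigfun M N / gauge N * \<Phi> N)" (is ?plus)
proof -
  define I where "I = inverse (q + inverse q)"
  have U: "prod_list (map (\<lambda>ui. Ufun q ui - r0 / (q + inverse q) * th q bd cd (2 * int N)) (Ybar n y k)) = I ^ n * \<Phi> N" for N
  proof -
    have "prod_list (map (\<lambda>ui. Ufun q ui - r0 / (q + inverse q) * th q bd cd (2 * int N)) (Ybar n y k))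
        = (\<Prod>i\<in>{1..n+1} - {k}. I * (joukowski (qarg (y i)) - qnode pA (q\<^sup>2) N))"
      unfolding prod_list_Ybar node_eq Ufun_def I_def
      by (intro prod.cong refl) (simp add: qarg_def joukowski_def divide_inverse algebra_simps)
    also have "\<dots> = I ^ n * \<Phi> N"
      using k by (simp add: prod.distrib \<Phi>_def)
    finally show ?thesis .
  qed
  have Qf: "Qfun q n r0 b c bs cs bd cd M N = inverse (nu q n r0 (bd, cd) (b, c) (bs, cs)) * (weight N * eigfun M N)"
    if "N \<le> n" for N
    unfolding Qfun_def using M that by (simp add: weight_eq eigfun_eq)
  have "(\<Sum>N=0..n. Qfun q n r0 b c bs cs bd cd M N * (I ^ n * \<Phi> N))
      = inverse (nu q n r0 (bd, cd) (b, c) (bs, cs)) * I ^ n * (\<Sum>N\<le>n. weight N * eigfun M N * \<Phi> N)"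
    unfolding sum_distrib_left atLeast0AtMost by (intro sum.cong refl) (simp add: Qf)
  then show ?minus
    unfolding Xfun_def Gfun_def U unfolding prod_list_Ybar I_def[symmetric] by (simp add: divide_inverse mult_ac)
  have "(\<Sum>N=0..n. Qfun q n r0 b c bs cs bd cd M N / Hfun q r0 b cs bd cd N * (I ^ n * \<Phi> N))
      = inverse (nu q n r0 (bd, cd) (b, c) (bs, cs)) * I ^ n * (\<Sum>N\<le>n. weight N * eigfun M N / gauge N * \<Phi> N)"
    unfolding sum_distrib_left atLeast0AtMost by (intro sum.cong refl) (simp add: Qf gauge_eq divide_inverse mult_ac)
  then show ?plus
    unfolding Xfun_def Gfun_def U unfolding prod_list_Ybar I_def[symmetric] by (simp add: divide_inverse mult_ac)
qed

lemma bethe_eigenvector: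
  fixes y :: "nat \<Rightarrow> complex"
  assumes y_nz: "\<And>i. i \<in> {1..n+1} \<Longrightarrow> y i \<noteq> 0"
    and y_gen: "\<And>i. i \<in> {1..n+1} \<Longrightarrow> y i ^ 4 \<noteq> 1 \<and> y i ^ 4 \<noteq> inverse (q\<^sup>2) \<and> y i ^ 4 \<noteq> inverse (q ^ 4)"
    and inj: "inj_on (\<lambda>i. joukowski (qarg (y i))) {1..n+1}"
    and M: "M \<le> n" and e: "e \<in> {1, - 1}" and j: "j \<in> {1..n+1}"
  shows "(\<Sum>k=1..n+1. (Lmat q n r0 b c bs cs bd cd zeta y e j k - (if j = k then th q b c (2 * int M) else 0))
          * Xfun q n r0 b c bs cs bd cd e M (Ybar n y k)) = 0"
proof -
  let ?S = "{1..n+1}" and ?V = "\<lambda>i. joukowski (qarg (y i))"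
  define f where "f x = (\<Prod>i\<in>?S - {j}. x - ?V i)" for x
  have fS: "finite (?S - {j})" "card (?S - {j}) = n" using j by auto
  have gen: "qarg (y k) \<noteq> 0" "(qarg (y k))\<^sup>2 \<noteq> 1" "q\<^sup>2 * (qarg (y k))\<^sup>2 \<noteq> 1" "(qarg (y k))\<^sup>2 \<noteq> q\<^sup>2"
    if "k \<in> ?S" for k
    using qarg_generic y_nz[OF that] y_gen[OF that] by blast+
  consider "e = - 1" | "e = 1" using e by auto
  then show ?thesis
  proof cases
    case 1
    obtain h where h: "degree h \<le> n"
      and hv: "\<And>v. v \<noteq> 0 \<Longrightarrow> v\<^sup>2 \<noteq> 1 \<Longrightarrow> q\<^sup>2 * v\<^sup>2 \<noteq> 1 \<Longrightarrow> v\<^sup>2 \<noteq> q\<^sup>2 \<Longrightarrow> poly h (joukowski v) =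
        hom.shift_coeff v * (f (joukowski (q\<^sup>2 * v)) - f (joukowski v))
        + hom.shift_coeff (inverse v) * (f (joukowski (v / q\<^sup>2)) - f (joukowski v))
        + (Eh + 0 * joukowski v) * f (joukowski v) - 0 * poly (newton_poly pA (q\<^sup>2) (Suc n)) (joukowski v)"
      and hn: "\<And>N. N \<le> n \<Longrightarrow> poly h (qnode pA (q\<^sup>2) N) =
        lattice_op n up_h down_h const_h (\<lambda>N. f (qnode pA (q\<^sup>2) N)) N"
      unfolding f_def using hom.monic_image[OF fS node_ne, of ?V] by blast
    show ?thesis
      unfolding 1
    proof (rule bethe_sum_eq_0[where h = h and w = "\<lambda>N. weight N * eigfun M N"
          and X = "Xfun q n r0 b c bs cs bd cd (- 1) M", OF y_nz y_gen inj j h _ _ Xfun_eq(1)[OF M]])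
      fix k assume k: "k \<in> ?S"
      show "poly h (?V k) = Yfun q n b c bs cs zeta (- 1) (y k) (Ybar n y j)
          + diag_coeff (qarg (y k)) * (\<Prod>i\<in>?S - {j}. ?V k - ?V i)"
        unfolding hv[OF gen[OF k]] f_def[symmetric]
        using Yfun_eq(1)[where y = y and j = j, OF y_nz[OF k] y_gen[OF k, THEN conjunct1] y_nz, folded f_def]
        by (simp add: diag_coeff_def algebra_simps)
    next
      show "(\<Sum>N\<le>n. weight N * eigfun M N * poly h (qnode pA (q\<^sup>2) N)) = th q b c (2 * int M)
          * (\<Sum>N\<le>n. weight N * eigfun M N * (\<Prod>i\<in>?S - {j}. qnode pA (q\<^sup>2) N - ?V i))"
        unfolding f_def[symmetric] eigen_eq[symmetric] hom_lattice_sum[OF M, symmetric]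
        by (intro sum.cong refl) (simp only: hn atMost_iff)
    qed
  next
    case 2
    obtain h where h: "degree h \<le> n"
      and hv: "\<And>v. v \<noteq> 0 \<Longrightarrow> v\<^sup>2 \<noteq> 1 \<Longrightarrow> q\<^sup>2 * v\<^sup>2 \<noteq> 1 \<Longrightarrow> v\<^sup>2 \<noteq> q\<^sup>2 \<Longrightarrow> poly h (joukowski v) =
        inhom.shift_coeff v * (f (joukowski (q\<^sup>2 * v)) - f (joukowski v))
        + inhom.shift_coeff (inverse v) * (f (joukowski (v / q\<^sup>2)) - f (joukowski v))
        + (Ei + c * Bp * joukowski v) * f (joukowski v)
        - c * Bp / (q\<^sup>2) ^ n * poly (newton_poly pA (q\<^sup>2) (Suc n)) (joukowski v)"
      and hn: "\<And>N. N \<le> n \<Longrightarrow> poly h (qnode pA (q\<^sup>2) N) =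
        lattice_op n up_i down_i const_i (\<lambda>N. f (qnode pA (q\<^sup>2) N)) N"
      unfolding f_def using inhom.monic_image[OF fS node_ne, of ?V] by blast
    show ?thesis
      unfolding 2
    proof (rule bethe_sum_eq_0[where h = h and w = "\<lambda>N. weight N * eigfun M N / gauge N"
          and X = "Xfun q n r0 b c bs cs bd cd 1 M", OF y_nz y_gen inj j h _ _ Xfun_eq(2)[OF M]])
      fix k assume k: "k \<in> ?S"
      \<comment> \<open>The delta term of \<open>Lmat\<close> does not depend on epsilon;
        \<open>diag_coeff_inhom\<close> expresses the same \<open>diag_coeff\<close> through the
        second operator.\<close>
      show "poly h (?V k) = Yfun q n b c bs cs zeta 1 (y k) (Ybar n y j)
          + diag_coeff (qarg (y k)) * (\<Prod>i\<in>?S - {j}. ?V k - ?V i)"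
        unfolding hv[OF gen[OF k]] f_def[symmetric] diag_coeff_inhom[OF gen[OF k]]
        using Yfun_eq(2)[where y = y and j = j, OF y_nz[OF k] y_gen[OF k, THEN conjunct1] y_nz, folded f_def]
        by (simp add: algebra_simps)
    next
      show "(\<Sum>N\<le>n. weight N * eigfun M N / gauge N * poly h (qnode pA (q\<^sup>2) N)) = th q b c (2 * int M)
          * (\<Sum>N\<le>n. weight N * eigfun M N / gauge N * (\<Prod>i\<in>?S - {j}. qnode pA (q\<^sup>2) N - ?V i))"
        unfolding f_def[symmetric] eigen_eq[symmetric] inhom_lattice_sum[OF M, symmetric]
        by (intro sum.cong refl) (simp only: hn atMost_iff)
    qed
  qed
qed

end

theorem theorem4p4:
  fixes q r0 b c bs cs bd cd zeta :: complex and n M :: nat and y :: "nat \<Rightarrow> complex"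
    and e :: int and j :: nat
  assumes q_nz: "q \<noteq> 0" and q_nru: "\<forall>m::nat. m > 0 \<longrightarrow> q ^ m \<noteq> 1"
    and nz: "r0 \<noteq> 0" "b \<noteq> 0" "c \<noteq> 0" "bs \<noteq> 0" "cs \<noteq> 0" "bd \<noteq> 0" "cd \<noteq> 0"
    and prods: "inverse (r0^2) = b * c" "inverse (r0^2) = bs * cs" "inverse (r0^2) = bd * cd"
    and nondeg: "nondeg q n r0 b c bs cs bd cd"
    and zeta: "zeta \<noteq> 0" "inverse (zeta^2) = bd * r0 * q ^ n"
    and y_nz: "\<forall>i\<in>{1..n+1}. y i \<noteq> 0"
    and y_gen: "\<forall>i\<in>{1..n+1}. (y i)^4 \<noteq> 1 \<and> (y i)^4 \<noteq> inverse (q^2) \<and> (y i)^4 \<noteq> inverse (q^4)"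
    and y_dist: "inj_on (\<lambda>i. (q * (y i)^2 + inverse (q * (y i)^2)) / (q + inverse q)) {1..n+1}"
    and standing: "standing q n r0 b c bs cs bd cd"
    and M: "M \<le> n"
    and e: "e \<in> {1, -1}"
    and j: "j \<in> {1..n+1}"
  shows "(\<Sum>k=1..n+1. (Lmat q n r0 b c bs cs bd cd zeta y e j k
            - (if j = k then th q b c (2 * int M) else 0))
          * Xfun q n r0 b c bs cs bd cd e M (Ybar n y k)) = 0"
proof -
  interpret aw_parameters q r0 b c bs cs bd cd zeta n
    by unfold_locales (use q_nz q_nru nz prods nondeg zeta in auto)
  have "inj_on (\<lambda>i. joukowski (qarg (y i))) {1..n+1}"
    using y_dist by (auto simp: inj_on_def joukowski_def qarg_def)
  with y_nz y_gen M e j show ?thesis by (intro bethe_eigenvector) auto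
qed

end
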